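(* Let $Q$ be a quadrangulation and $e$ an inner edge of $Q$. Let $Q'_e$ and $Q''_e$ be the open quadrangulations obtained by cutting $Q$ along the edge $e$ (with the edge $e$ as open edge in both). Then the $h$-vector of $Q$ is given by $$h_Q(x)=h_{Q'_e}(x,t)\,\#\,h_{Q''_e}(x,t).$$
   Context: Quadrangulations. A quadrangulation is a set of pairwise noncrossing diagonals (inner edges) of a convex polygon with an even number of vertices, cutting it into quadrilaterals (called squares). Two squares are adjacent if they share an inner edge; with this adjacency the squares form a tree. Cutting $Q$ along an inner edge $e$ gives two quadrangulations (the two sides of $e$), in each of which $e$ becomes a boundary edge. Serpents. A serpent in $Q$ is a set of two distinct squares $\{s',s''\}$ (its extremities) such that the unique path of squares from $s'$ to $s''$ makes a right-angle turn in each intermediate square, i.e. never enters and leaves a square through opposite sides. The serpent is also identified with this path, drawn from the centre of $s'$ to the centre of $s''$. Serpent nests. A serpent nest in $Q$ is an equivalence class of sets of serpents in $Q$ satisfying the condition: two serpent extremities may lie in the same square only if the corresponding serpents do not leave this square by the same side. Two such sets are equivalent if the pattern of paths inside every square is the same for both: for each square and each of its four sides, the number of path segments going from this side to the centre (and stopping there) is the same, and for each square and each of its four pairs of adjacent sides, the number of path segments entering by one and leaving by the other is the same. $\mathrm{SN}_Q$ is the set of serpent nests in $Q$. The rank $\operatorname{rk}(\sigma)$ of a serpent nest $\sigma$ is the number of serpents in it. The $h$-vector is $h_Q(x)=\sum_{\sigma\in \mathrm{SN}_Q}x^{\operatorname{rk}(\sigma)}$. Open versions. An open quadrangulation is a quadrangulation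 with a distinguished boundary edge, the open edge. An open serpent is a path starting at the centre of a square and ending on the open edge, making a right-angle turn in every square it traverses after its starting square (including the square next to the open edge, if that is not the starting square). An open serpent nest in an open quadrangulation is defined like a serpent nest, using (closed) serpents and open serpents, with the same condition on the extremities located at centres of squares and the same equivalence relation. For an open serpent nest $\sigma$, the rank $\operatorname{rk}(\sigma)$ is the number of closed serpents (those not ending on the open edge), and $\operatorname{op}(\sigma)$ is the number of open serpents. For an open quadrangulation $R$, the open $h$-vector is $h_R(x,t)=\sum_{\sigma}x^{\operatorname{rk}(\sigma)}t^{\operatorname{op}(\sigma)}$, the sum being over open serpent nests in $R$. Gluing. For polynomials $A,B$ in $x$ and $t$, $A\# B=\sum_{k\ge0}A_kB_kx^k$, where $A_k,B_k\in\mathbb{Z}[x]$ are the coefficients of $t^k$ in $A$ and $B$. *)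

theory Defs
  imports Main "HOL-Computational_Algebra.Polynomial"
begin

section \<open>Quadrangulations\<close>

text \<open>
  A convex polygon is encoded by the finite set of its vertices, labelled by natural numbers
  in cyclic order. Arbitrary finite sets of labels are allowed, so that the pieces of a cut
  polygon, and the squares of a quadrangulation, are again polygons on some of the same vertices.
\<close>

type_synonym edge = "nat set"
type_synonym square = "nat set"

definition polygon_sides :: "nat set \<Rightarrow> edge set" where
  "polygon_sides V = {{u, v} | u v. u \<in> V \<and> v \<in> V \<and> u < v \<and>
     ((\<forall>w\<in>V. \<not> (u < w \<and> w < v)) \<or> (\<forall>w\<in>V. u \<le> w \<and> w \<le> v))}"

definition polygon_diagonals :: "nat set \<Rightarrow> edge set" where
  "polygon_diagonals V = {{u, v} | u v. u \<in> V \<and> v \<in> V \<and> u < v} - polygon_sides V"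

definition crossing :: "edge \<Rightarrow> edge \<Rightarrow> bool" where
  "crossing d d' \<longleftrightarrow> (\<exists>a b c f. a < b \<and> b < c \<and> c < f \<and>
     (d = {a, c} \<and> d' = {b, f} \<or> d = {b, f} \<and> d' = {a, c}))"

record dissection =
  verts :: "nat set"
  inner_edges :: "edge set"

text \<open>
  The regions into which pairwise noncrossing inner edges cut the polygon, each given by its
  set of vertices: polygons bounded by boundary or inner edges and not cut further.
\<close>

definition cells :: "dissection \<Rightarrow> nat set set" where
  "cells Q = {C. C \<subseteq> verts Q \<and> 3 \<le> card C \<and>
     polygon_sides C \<subseteq> polygon_sides (verts Q) \<union> inner_edges Q \<and>
     polygon_diagonals C \<inter> inner_edges Q = {}}"

definition quadrangulation :: "dissection \<Rightarrow> bool" where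
  "quadrangulation Q \<longleftrightarrow>
     finite (verts Q) \<and> 4 \<le> card (verts Q) \<and> even (card (verts Q)) \<and>
     inner_edges Q \<subseteq> polygon_diagonals (verts Q) \<and>
     (\<forall>d\<in>inner_edges Q. \<forall>d'\<in>inner_edges Q. \<not> crossing d d') \<and>
     (\<forall>C\<in>cells Q. card C = 4)"

abbreviation squares :: "dissection \<Rightarrow> square set" where
  "squares Q \<equiv> cells Q"

text \<open>
  The two sides of an inner edge \<open>e = {a, b}\<close> with \<open>a < b\<close>: the vertices from \<open>a\<close> to \<open>b\<close>,
  and those from \<open>b\<close> cyclically round to \<open>a\<close>. In both, \<open>e\<close> becomes a boundary edge.
\<close>

definition restrict_dissection :: "dissection \<Rightarrow> edge \<Rightarrow> nat set \<Rightarrow> dissection" where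
  "restrict_dissection Q e W =
     \<lparr>verts = W, inner_edges = {d \<in> inner_edges Q. d \<subseteq> W \<and> d \<noteq> e}\<rparr>"

definition cut_between :: "dissection \<Rightarrow> edge \<Rightarrow> dissection" where
  "cut_between Q e = restrict_dissection Q e {v \<in> verts Q. Min e \<le> v \<and> v \<le> Max e}"

definition cut_around :: "dissection \<Rightarrow> edge \<Rightarrow> dissection" where
  "cut_around Q e = restrict_dissection Q e {v \<in> verts Q. v \<le> Min e \<or> Max e \<le> v}"

section \<open>Serpents\<close>

text \<open>
  \<open>square_path Q ss es\<close>: the squares \<open>ss\<close> form a path for adjacency, and \<open>es\<close> are
  the inner edges crossed successively. In a quadrangulation such a path is determined by its
  two end squares, since the squares form a tree.
\<close>

definition square_path :: "dissection \<Rightarrow> square list \<Rightarrow> edge list \<Rightarrow> bool" where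
  "square_path Q ss es \<longleftrightarrow>
     length ss = Suc (length es) \<and> distinct ss \<and> set ss \<subseteq> squares Q \<and>
     (\<forall>i<length es. es ! i \<in> inner_edges Q \<and>
        es ! i \<in> polygon_sides (ss ! i) \<and> es ! i \<in> polygon_sides (ss ! Suc i))"

text \<open>
  Two different sides of a square are opposite if they are disjoint, and adjacent
  if they share a vertex. Two consecutive crossed edges are different sides of the square
  traversed between them.
\<close>

definition right_angle_turns :: "edge list \<Rightarrow> bool" where
  "right_angle_turns es \<longleftrightarrow> successively (\<lambda>a b. a \<inter> b \<noteq> {}) es"

text \<open>
  A closed serpent is given by the set of its two extremities, an open serpent by its
  starting square and the open edge on which it ends.
\<close>

datatype serpent =
    is_closed: Closed_Serpent "square set"
  | is_open: Open_Serpent square edge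

text \<open>The edges met successively by the path (for an open serpent, the open edge comes last).\<close>

fun route :: "dissection \<Rightarrow> serpent \<Rightarrow> edge list \<Rightarrow> bool" where
  "route Q (Closed_Serpent S) es \<longleftrightarrow>
     (\<exists>ss. square_path Q ss es \<and> hd ss \<noteq> last ss \<and> S = {hd ss, last ss})"
| "route Q (Open_Serpent s e) es \<longleftrightarrow>
     (\<exists>ss es'. square_path Q ss es' \<and> hd ss = s \<and> e \<in> polygon_sides (last ss) \<and> es = es' @ [e])"

definition closed_serpents :: "dissection \<Rightarrow> serpent set" where
  "closed_serpents Q =
     {Closed_Serpent S | S. \<exists>es. route Q (Closed_Serpent S) es \<and> right_angle_turns es}"

definition open_serpents :: "dissection \<Rightarrow> edge \<Rightarrow> serpent set" where
  "open_serpents Q e =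
     {Open_Serpent s e | s. \<exists>es. route Q (Open_Serpent s e) es \<and> right_angle_turns es}"

definition path_edges :: "dissection \<Rightarrow> serpent \<Rightarrow> edge set" where
  "path_edges Q \<sigma> = {a. \<exists>es. route Q \<sigma> es \<and> a \<in> set es}"

text \<open>The extremities at centres of squares.\<close>

fun extremities :: "serpent \<Rightarrow> square set" where
  "extremities (Closed_Serpent S) = S"
| "extremities (Open_Serpent s e) = {s}"

definition leaves_by :: "dissection \<Rightarrow> serpent \<Rightarrow> square \<Rightarrow> edge \<Rightarrow> bool" where
  "leaves_by Q \<sigma> s a \<longleftrightarrow> s \<in> extremities \<sigma> \<and> a \<in> polygon_sides s \<and> a \<in> path_edges Q \<sigma>"

text \<open>A path meeting two different sides of a square enters it by one and leaves it by the other.\<close>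

definition traverses :: "dissection \<Rightarrow> serpent \<Rightarrow> square \<Rightarrow> edge \<Rightarrow> edge \<Rightarrow> bool" where
  "traverses Q \<sigma> s a b \<longleftrightarrow> a \<in> polygon_sides s \<and> b \<in> polygon_sides s \<and> a \<noteq> b \<and>
     a \<in> path_edges Q \<sigma> \<and> b \<in> path_edges Q \<sigma>"

section \<open>Serpent nests\<close>

definition compatible :: "dissection \<Rightarrow> serpent set \<Rightarrow> bool" where
  "compatible Q \<Sigma> \<longleftrightarrow> (\<forall>\<sigma>\<in>\<Sigma>. \<forall>\<tau>\<in>\<Sigma>. \<sigma> \<noteq> \<tau> \<longrightarrow>
     (\<forall>s a. \<not> (leaves_by Q \<sigma> s a \<and> leaves_by Q \<tau> s a)))"

definition same_pattern :: "dissection \<Rightarrow> serpent set \<Rightarrow> serpent set \<Rightarrow> bool" where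
  "same_pattern Q \<Sigma> T \<longleftrightarrow> (\<forall>s\<in>squares Q.
     (\<forall>a\<in>polygon_sides s. card {\<sigma>\<in>\<Sigma>. leaves_by Q \<sigma> s a} = card {\<sigma>\<in>T. leaves_by Q \<sigma> s a}) \<and>
     (\<forall>a\<in>polygon_sides s. \<forall>b\<in>polygon_sides s. a \<noteq> b \<and> a \<inter> b \<noteq> {} \<longrightarrow>
        card {\<sigma>\<in>\<Sigma>. traverses Q \<sigma> s a b} = card {\<sigma>\<in>T. traverses Q \<sigma> s a b}))"

definition nests_of :: "dissection \<Rightarrow> serpent set \<Rightarrow> serpent set set set" where
  "nests_of Q A = {\<Sigma>. \<Sigma> \<subseteq> A \<and> compatible Q \<Sigma>} //
     {(\<Sigma>, T). \<Sigma> \<subseteq> A \<and> compatible Q \<Sigma> \<and> T \<subseteq> A \<and> compatible Q T \<and> same_pattern Q \<Sigma> T}"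

definition serpent_nests :: "dissection \<Rightarrow> serpent set set set" where
  "serpent_nests Q = nests_of Q (closed_serpents Q)"

definition open_serpent_nests :: "dissection \<Rightarrow> edge \<Rightarrow> serpent set set set" where
  "open_serpent_nests Q e = nests_of Q (closed_serpents Q \<union> open_serpents Q e)"

text \<open>
  The numbers of closed and of open serpents are the same for all representatives of a nest:
  the pattern determines the number of paths meeting the open edge and the number of extremities
  at centres. So the images below are singletons.
\<close>

definition rk :: "serpent set set \<Rightarrow> nat" where
  "rk N = the_elem ((\<lambda>\<Sigma>. card {\<sigma>\<in>\<Sigma>. is_closed \<sigma>}) ` N)"

definition op_rk :: "serpent set set \<Rightarrow> nat" where
  "op_rk N = the_elem ((\<lambda>\<Sigma>. card {\<sigma>\<in>\<Sigma>. is_open \<sigma>}) ` N)"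

section \<open>The \<open>h\<close>-vectors\<close>

definition h_vector :: "dissection \<Rightarrow> int poly" where
  "h_vector Q = (\<Sum>N\<in>serpent_nests Q. monom 1 (rk N))"

text \<open>Polynomials in \<open>x\<close> and \<open>t\<close> are polynomials in \<open>t\<close> whose coefficients are polynomials in \<open>x\<close>.\<close>

definition open_h_vector :: "dissection \<Rightarrow> edge \<Rightarrow> int poly poly" where
  "open_h_vector Q e = (\<Sum>N\<in>open_serpent_nests Q e. monom (monom 1 (rk N)) (op_rk N))"

definition glue :: "int poly poly \<Rightarrow> int poly poly \<Rightarrow> int poly" where
  "glue A B = (\<Sum>k\<le>max (degree A) (degree B). coeff A k * coeff B k * monom 1 k)"

end

theory Submission
  imports Defs
begin

text \<open>
  Cut \<open>Q\<close> along \<open>e\<close>. A closed serpent of \<open>Q\<close> either stays on one side of \<open>e\<close>, or crosses \<open>e\<close>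
  exactly once and breaks there into an open serpent on each side. The condition on turns also
  splits: the turns in the two squares next to \<open>e\<close> are just the turns that the two
  open serpents make towards the open edge. Restricting every member of a set of serpents to one
  side gives its trace there, and the two traces have the same number of open serpents.

  Conversely, two compatible sets with equally many open serpents are glued by pairing their open
  serpents by any bijection whatsoever. The resulting set of serpents depends on the bijection,
  but its pattern in every square does not, and a nest is only a pattern. So nests of \<open>Q\<close>
  correspond to pairs of open nests with equal numbers of open serpents (\<open>bij_betw_nests_on_sides\<close>).
  If that number is \<open>k\<close>, the closed serpents of \<open>Q\<close> are those of the two sides and \<open>k\<close>
  further ones, which explains the factor \<open>x\<^sup>k\<close> in the gluing product (\<open>glue_sum_monom\<close>).

  Compatibility is what makes cutting reversible: two serpents of a compatible set that had the same
  piece on one side would leave a common extremity by the same side of the square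
  (\<open>inj_on_piece\<close>). A square of \<open>Q\<close> belongs to exactly one side and sees of a serpent only its
  piece there (\<open>leaves_by_piece\<close>, \<open>traverses_piece\<close>), so the numbers that make up a pattern are the
  same for a set of serpents and for its traces (\<open>same_pattern_trace\<close>).

  Two facts underlie this. Geometrically, every square lies on one side of an inner edge, and on
  each side at most one square has this edge on its boundary (\<open>cell_on_one_side\<close>,
  \<open>unique_cell_at_edge\<close>). Hence a path of distinct squares crosses an inner edge iff the edge
  separates its ends, so the edges of a path are determined by its ends (\<open>set_square_path\<close>):
  this is the tree structure in the only form in which it is used. Secondly, \<open>rk\<close> and \<open>op_rk\<close>
  must be functions of the pattern: open serpents are counted by their arrivals at the
  open edge, and extremities by the segments ending at the centres of squares
  (\<open>same_pattern_same_ranks\<close>).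
\<close>

section \<open>Chords, sides and gaps\<close>

text \<open>
  The two open sides of a chord, selected by a Boolean so that the between and the around part of a
  polygon can be treated by one argument: \<open>\<not> b\<close> is always the side opposite to \<open>b\<close>.
\<close>

definition beyond :: "bool \<Rightarrow> edge \<Rightarrow> nat set" where
  "beyond b d = (if b then {x. Min d < x \<and> x < Max d} else {x. x < Min d \<or> Max d < x})"

lemma two_set_cases:
  fixes d :: edge
  assumes "card d = 2"
  obtains u v where "d = {u, v}" "u < v" "beyond True d = {x. u < x \<and> x < v}"
    "beyond False d = {x. x < u \<or> v < x}"
proof -
  obtain x y where xy: "d = {x, y}" "x \<noteq> y" using assms by (auto simp: card_2_iff)
  define u v where "u = min x y" and "v = max x y"
  have "d = {u, v}" "u < v" using xy by (auto simp: u_def v_def)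
  moreover from this have "Min d = u" "Max d = v" by auto
  ultimately show thesis using that by (auto simp: beyond_def)
qed

lemma beyond_cover:
  assumes "card d = 2" and "x \<notin> d"
  shows "x \<in> beyond b d \<or> x \<in> beyond (\<not> b) d"
proof -
  have "finite d" "d \<noteq> {}" using assms(1) by (auto intro: card_ge_0_finite)
  then have "x \<noteq> Min d" "x \<noteq> Max d" using assms(2) Min_in Max_in by metis+
  then show ?thesis unfolding beyond_def by (cases b) auto
qed

lemma beyond_disjoint:
  assumes "card d = 2" and "x \<in> beyond b d"
  shows "x \<notin> d" and "x \<notin> beyond (\<not> b) d"
proof -
  obtain u v where d: "d = {u, v}" "u < v" "beyond True d = {x. u < x \<and> x < v}"
    "beyond False d = {x. x < u \<or> v < x}" by (rule two_set_cases[OF assms(1)])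
  have "x \<noteq> u \<and> x \<noteq> v" using assms(2) d(2-4) by (cases b) auto
  then show "x \<notin> d" unfolding d(1) by simp
  show "x \<notin> beyond (\<not> b) d" using assms(2) d(2-4) by (cases b) auto
qed

lemma card_2_edge_iff: "card (d :: edge) = 2 \<longleftrightarrow> (\<exists>u v. d = {u, v} \<and> u < v)"
proof
  assume "card d = 2"
  then show "\<exists>u v. d = {u, v} \<and> u < v" by (rule two_set_cases) blast
qed auto

lemma polygon_sides_iff:
  "d \<in> polygon_sides V \<longleftrightarrow> card d = 2 \<and> d \<subseteq> V \<and> (\<exists>b. V \<inter> beyond b d = {})"
proof -
  have side: "(\<forall>w\<in>V. \<not> (u < w \<and> w < v)) \<or> (\<forall>w\<in>V. u \<le> w \<and> w \<le> v) \<longleftrightarrow>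
      (\<exists>b. V \<inter> beyond b {u, v} = {})" if "u < v" for u v
  proof -
    have "Min {u, v} = u" "Max {u, v} = v" using that by auto
    then have "V \<inter> beyond True {u, v} = {} \<longleftrightarrow> (\<forall>w\<in>V. \<not> (u < w \<and> w < v))"
      and "V \<inter> beyond False {u, v} = {} \<longleftrightarrow> (\<forall>w\<in>V. u \<le> w \<and> w \<le> v)"
      by (auto simp: beyond_def disjoint_iff not_less)
    then show ?thesis by (metis (full_types))
  qed
  have "d \<in> polygon_sides V \<longleftrightarrow>
      (\<exists>u v. d = {u, v} \<and> u < v \<and> {u, v} \<subseteq> V \<and> (\<exists>b. V \<inter> beyond b {u, v} = {}))"
    unfolding polygon_sides_def mem_Collect_eq by (intro iff_exI) (use side in auto)
  also have "\<dots> \<longleftrightarrow> (\<exists>u v. d = {u, v} \<and> u < v) \<and> d \<subseteq> V \<and> (\<exists>b. V \<inter> beyond b d = {})"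
    by auto
  finally show ?thesis unfolding card_2_edge_iff .
qed

lemma polygon_diagonals_iff:
  "d \<in> polygon_diagonals V \<longleftrightarrow> card d = 2 \<and> d \<subseteq> V \<and> (\<forall>b. V \<inter> beyond b d \<noteq> {})"
proof -
  have "(\<exists>u v. d = {u, v} \<and> u \<in> V \<and> v \<in> V \<and> u < v) \<longleftrightarrow>
      (\<exists>u v. d = {u, v} \<and> u < v) \<and> d \<subseteq> V" by auto
  then show ?thesis
    unfolding polygon_diagonals_def Diff_iff mem_Collect_eq polygon_sides_iff card_2_edge_iff
    by blast
qed

lemma crossing_if_meets_both_sides:
  assumes "card d = 2" and "card f = 2" and "\<And>b. d \<inter> beyond b f \<noteq> {}"
  shows "crossing d f"
proof (rule two_set_cases[OF assms(1)], rule two_set_cases[OF assms(2)])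
  fix u v p q
  assume d: "d = {u, v}" "u < v" and f: "f = {p, q}" "p < q"
    "beyond True f = {x. p < x \<and> x < q}" "beyond False f = {x. x < p \<or> q < x}"
  have "p < u \<and> u < q \<or> p < v \<and> v < q" using assms(3)[of True] unfolding d(1) f(3) by auto
  moreover have "u < p \<or> q < u \<or> v < p \<or> q < v"
    using assms(3)[of False] unfolding d(1) f(4) by auto
  ultimately have "u < p \<and> p < v \<and> v < q \<or> p < u \<and> u < q \<and> q < v"
    using d(2) f(2) by linarith
  then show ?thesis
  proof
    assume "u < p \<and> p < v \<and> v < q"
    then show ?thesis unfolding crossing_def d(1) f(1)
      by (intro exI[of _ u] exI[of _ p] exI[of _ v] exI[of _ q]) simp
  next
    assume "p < u \<and> u < q \<and> q < v"
    then show ?thesis unfolding crossing_def d(1) f(1)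
      by (intro exI[of _ p] exI[of _ u] exI[of _ q] exI[of _ v]) simp
  qed
qed

text \<open>
  Intervals that do not cross are nested or disjoint up to end points; in each case the far side of
  one chord is swallowed by a single side of the other. This transfers a position relative to
  \<open>f\<close> into one relative to \<open>d\<close>.
\<close>

lemma closed_side_subset:
  assumes "card d = 2" and "card f = 2" and "d \<inter> beyond (\<not> b) f = {}"
  obtains c where "beyond (\<not> b) f \<union> f \<subseteq> beyond c d \<union> d"
proof (rule two_set_cases[OF assms(1)], rule two_set_cases[OF assms(2)])
  fix u v p q
  assume d: "d = {u, v}" "u < v" "beyond True d = {x. u < x \<and> x < v}"
      "beyond False d = {x. x < u \<or> v < x}"
    and f: "f = {p, q}" "p < q"
    "beyond True f = {x. p < x \<and> x < q}" "beyond False f = {x. x < p \<or> q < x}"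
  have "\<exists>c. beyond (\<not> b) f \<union> f \<subseteq> beyond c d \<union> d"
  proof (cases b)
    case True
    then have "p \<le> u" "v \<le> q" using assms(3) d f by auto
    then have "beyond (\<not> b) f \<union> f \<subseteq> beyond False d \<union> d" using d f True by auto
    then show ?thesis by blast
  next
    case False
    then have F: "u \<le> p \<or> q \<le> u" "v \<le> p \<or> q \<le> v" using assms(3) d f by auto
    show ?thesis
    proof (cases "u \<le> p \<and> q \<le> v")
      case True
      then have "beyond (\<not> b) f \<union> f \<subseteq> beyond True d \<union> d" using d f False by auto
      then show ?thesis by blast
    next
      case nested: False
      then have "v \<le> p \<or> q \<le> u" using F d by auto
      then have "beyond (\<not> b) f \<union> f \<subseteq> beyond False d \<union> d" using d f False by auto
      then show ?thesis by blast
    qed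
  qed
  then show thesis using that by blast
qed

text \<open>
  A polygon is the intersection of the closed half planes of its sides, so a vertex outside it is cut
  off by one of them: the side joining the neighbours of \<open>x\<close> in \<open>C\<close>, or the side
  joining the extreme vertices of \<open>C\<close> if \<open>x\<close> lies beyond them.
\<close>

lemma side_facing_vertex:
  assumes "finite C" and "2 \<le> card C" and "x \<notin> C"
  obtains f b where "f \<in> polygon_sides C" "x \<in> beyond b f" "C \<inter> beyond b f = {}"
proof -
  have ne: "C \<noteq> {}" using assms by auto
  have "\<exists>f b. card f = 2 \<and> f \<subseteq> C \<and> x \<in> beyond b f \<and> C \<inter> beyond b f = {}"
  proof (cases "(\<exists>y\<in>C. y < x) \<and> (\<exists>y\<in>C. x < y)")
    case True
    define p q where "p = Max {y \<in> C. y < x}" and "q = Min {y \<in> C. x < y}"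
    have "p \<in> {y \<in> C. y < x}" unfolding p_def by (rule Max_in) (use True assms(1) in auto)
    moreover have "q \<in> {y \<in> C. x < y}" unfolding q_def
      by (rule Min_in) (use True assms(1) in auto)
    ultimately have p: "p \<in> C" "p < x" and q: "q \<in> C" "x < q" by auto
    have "y \<le> p" if "y \<in> C" "y < x" for y using that assms(1) by (auto simp: p_def)
    moreover have "q \<le> y" if "y \<in> C" "x < y" for y using that assms(1) by (auto simp: q_def)
    ultimately have gap: "\<not> (p < y \<and> y < q)" if "y \<in> C" for y
      using that assms(3) by (metis leD linorder_neqE_nat)
    have pq: "p < q" using p q by simp
    then have "Min {p, q} = p" "Max {p, q} = q" by auto
    then have "x \<in> beyond True {p, q}" "C \<inter> beyond True {p, q} = {}"
      using p q gap by (auto simp: beyond_def)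
    moreover have "card {p, q} = 2" using pq by simp
    ultimately show ?thesis using p q by blast
  next
    case False
    have lt: "Min C < Max C"
    proof (rule ccontr)
      assume "\<not> ?thesis"
      then have "y = Min C" if "y \<in> C" for y
        using Min_le[OF assms(1) that] Max_ge[OF assms(1) that] by linarith
      then have "C \<subseteq> {Min C}" by blast
      then have "card C \<le> card {Min C}" by (rule card_mono[rotated]) simp
      then show False using assms(2) by simp
    qed
    define f where "f = {Min C, Max C}"
    have mm: "Min f = Min C" "Max f = Max C" using lt by (auto simp: f_def)
    have "Min C \<in> C" "Max C \<in> C" using ne assms(1) by auto
    then have "x < Min C \<or> Max C < x"
      using False assms(3) by (metis linorder_neqE_nat)
    then have "x \<in> beyond False f" "C \<inter> beyond False f = {}"
      using assms(1) mm by (auto simp: beyond_def leD)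
    moreover have "card f = 2" using lt by (simp add: f_def)
    ultimately show ?thesis using \<open>Min C \<in> C\<close> \<open>Max C \<in> C\<close> unfolding f_def by blast
  qed
  then show thesis using that by (auto simp: polygon_sides_iff)
qed

section \<open>Cells and inner edges\<close>

definition half :: "bool \<Rightarrow> dissection \<Rightarrow> edge \<Rightarrow> dissection" where
  "half b Q e = restrict_dissection Q e (verts Q \<inter> (beyond b e \<union> e))"

lemma verts_half [simp]: "verts (half b Q e) = verts Q \<inter> (beyond b e \<union> e)"
  and inner_edges_half [simp]: "inner_edges (half b Q e) =
    {d \<in> inner_edges Q. d \<subseteq> verts Q \<inter> (beyond b e \<union> e) \<and> d \<noteq> e}"
  by (simp_all add: half_def restrict_dissection_def)

text \<open>
  The conditions that make the cells a tree. They pass to the two pieces of a cut polygon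
  (\<open>dissected_polygon_half\<close>), so that everything about paths and serpents is
  available on both sides of an inner edge as well as in the whole polygon.
\<close>

locale dissected_polygon =
  fixes Q :: dissection
  assumes finite_verts: "finite (verts Q)"
    and inner_edges_diagonals: "inner_edges Q \<subseteq> polygon_diagonals (verts Q)"
    and noncrossing: "d \<in> inner_edges Q \<Longrightarrow> d' \<in> inner_edges Q \<Longrightarrow> \<not> crossing d d'"
begin

lemma inner_edge: "d \<in> inner_edges Q \<Longrightarrow> card d = 2 \<and> d \<subseteq> verts Q"
  using inner_edges_diagonals polygon_diagonals_iff by blast

lemma cell: "C \<in> cells Q \<Longrightarrow> C \<subseteq> verts Q \<and> 3 \<le> card C \<and> finite C"
  using finite_verts finite_subset by (auto simp: cells_def)

lemma finite_cells: "finite (cells Q)"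
  by (rule finite_subset[of _ "Pow (verts Q)"]) (auto simp: cells_def finite_verts)

lemma finite_polygon_sides: "C \<in> cells Q \<Longrightarrow> finite (polygon_sides C)"
  by (rule finite_subset[of _ "Pow C"]) (auto simp: cell polygon_sides_iff)

lemma side_not_crossed:
  assumes C: "C \<in> cells Q" and f: "f \<in> polygon_sides C" and x: "x \<in> d" "x \<in> beyond b f"
    and d: "d \<in> inner_edges Q"
  shows "d \<inter> beyond (\<not> b) f = {}"
proof (rule ccontr)
  assume ne: "\<not> ?thesis"
  have meets: "d \<inter> beyond c f \<noteq> {}" for c using ne x by (cases "c = b") auto
  have "f \<in> polygon_sides (verts Q) \<or> f \<in> inner_edges Q" using C f by (auto simp: cells_def)
  then show False
  proof
    assume "f \<in> polygon_sides (verts Q)"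
    then show False using meets inner_edge[OF d] by (fastforce simp: polygon_sides_iff)
  next
    assume "f \<in> inner_edges Q"
    then show False
      using crossing_if_meets_both_sides[OF _ _ meets] inner_edge d noncrossing by blast
  qed
qed

text \<open>
  If both ends of \<open>d\<close> are vertices of \<open>C\<close>, then \<open>d\<close> is a side of \<open>C\<close>, since cells
  have no inner edge as diagonal. Otherwise a side \<open>f\<close> of \<open>C\<close> cuts off an end of \<open>d\<close>;
  as \<open>d\<close> does not cross \<open>f\<close>, the whole of \<open>d\<close> is beyond \<open>f\<close>, and \<open>C\<close> is on
  the other side of \<open>f\<close>.
\<close>

lemma cell_on_one_side:
  assumes C: "C \<in> cells Q" and d: "d \<in> inner_edges Q"
  obtains b where "C \<inter> beyond (\<not> b) d = {}"
proof (cases "d \<subseteq> C")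
  case True
  moreover have "d \<notin> polygon_diagonals C" using C d by (auto simp: cells_def)
  ultimately obtain b where "C \<inter> beyond b d = {}"
    using inner_edge[OF d] unfolding polygon_diagonals_iff by blast
  then show thesis using that[of "\<not> b"] by simp
next
  case False
  then obtain x where x: "x \<in> d" "x \<notin> C" by blast
  have "finite C" "2 \<le> card C" using cell[OF C] by auto
  then obtain f b where f: "f \<in> polygon_sides C" "x \<in> beyond b f" "C \<inter> beyond b f = {}"
    using side_facing_vertex[OF _ _ x(2)] by blast
  have card: "card d = 2" "card f = 2" using inner_edge[OF d] f by (auto simp: polygon_sides_iff)
  obtain c where c: "beyond (\<not> b) f \<union> f \<subseteq> beyond c d \<union> d"
    using closed_side_subset[OF card side_not_crossed[OF C f(1) x(1) f(2) d]] .
  have "C \<subseteq> beyond (\<not> b) f \<union> f" using f(3) beyond_cover[OF card(2)] by blast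
  then have "C \<inter> beyond (\<not> c) d = {}" using c beyond_disjoint[OF card(1)] by blast
  then show thesis using that by blast
qed

text \<open>
  A vertex \<open>x\<close> of \<open>C\<close> outside \<open>C'\<close> is cut off by a side \<open>f\<close> of \<open>C'\<close>. This side is
  not \<open>d\<close>, since both cells are on the same side of \<open>d\<close>, so an end of \<open>d\<close> lies strictly on the other side of
  \<open>f\<close>. Then \<open>f\<close> has vertices on both sides, so it is an inner edge, and \<open>C\<close>, which contains \<open>x\<close>
  and \<open>d\<close>, has vertices on both sides of it, which is impossible.
\<close>

lemma unique_cell_at_edge:
  assumes C: "C \<in> cells Q" "C' \<in> cells Q" and d: "d \<in> inner_edges Q"
    and "d \<subseteq> C" "d \<subseteq> C'" and side: "C \<inter> beyond (\<not> b) d = {}" "C' \<inter> beyond (\<not> b) d = {}"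
  shows "C = C'"
proof -
  have sub: "C \<subseteq> C'" if C: "C \<in> cells Q" "C' \<in> cells Q" and "d \<subseteq> C" "d \<subseteq> C'"
    and side: "C \<inter> beyond (\<not> b) d = {}" "C' \<inter> beyond (\<not> b) d = {}" for C C'
  proof (rule ccontr)
    assume "\<not> C \<subseteq> C'"
    then obtain x where x: "x \<in> C" "x \<notin> C'" by blast
    have "finite C'" "2 \<le> card C'" using cell[OF C(2)] by auto
    then obtain f c where f: "f \<in> polygon_sides C'" "x \<in> beyond c f" "C' \<inter> beyond c f = {}"
      using side_facing_vertex[OF _ _ x(2)] by blast
    have card: "card d = 2" "card f = 2" using inner_edge[OF d] f by (auto simp: polygon_sides_iff)
    have "f \<noteq> d"
    proof
      assume "f = d"
      then have "x \<notin> beyond (\<not> b) d" using side x by blast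
      then have "c = b" using f(2) \<open>f = d\<close> by (cases "c = b") auto
      then have "C' \<subseteq> d" using \<open>f = d\<close> f(3) side beyond_cover[OF card(1), of _ b] by blast
      then have "card C' \<le> 2" using card by (metis card_mono card.infinite zero_neq_numeral)
      then show False using cell[OF C(2)] by simp
    qed
    have "\<not> d \<subseteq> f" using \<open>f \<noteq> d\<close> card by (metis card_subset_eq card.infinite zero_neq_numeral)
    then obtain y where y: "y \<in> d" "y \<notin> f" by blast
    then have y': "y \<in> beyond (\<not> c) f"
      using f(3) \<open>d \<subseteq> C'\<close> beyond_cover[OF card(2), of y c] by blast
    have "x \<in> verts Q" "y \<in> verts Q" using x y cell C \<open>d \<subseteq> C\<close> by blast+
    then have "verts Q \<inter> beyond c' f \<noteq> {}" for c'
      using f(2) y' by (cases "c' = c") auto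
    then have "f \<notin> polygon_sides (verts Q)" by (simp add: polygon_sides_iff)
    then have "f \<in> inner_edges Q" using C(2) f(1) by (auto simp: cells_def)
    then obtain c' where "C \<inter> beyond (\<not> c') f = {}" using cell_on_one_side C(1) by blast
    then show False using x y y' f(2) \<open>d \<subseteq> C\<close> by (cases "c' = c") auto
  qed
  show ?thesis using sub assms by blast
qed

text \<open>
  Cutting along \<open>e\<close> creates no new side except \<open>e\<close>: the vertices removed all lie on one side of any
  chord of the remaining part, and on the same closed side as \<open>e\<close>.
\<close>

lemma polygon_sides_half:
  assumes e: "e \<in> inner_edges Q" and d: "d \<in> polygon_sides (verts (half b Q e))" "d \<noteq> e"
  shows "d \<in> polygon_sides (verts Q)"
proof -
  let ?W = "verts (half b Q e)"
  have ce: "card e = 2" "e \<subseteq> verts Q" using inner_edge[OF e] by auto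
  obtain c where cd: "card d = 2" "d \<subseteq> ?W" "?W \<inter> beyond c d = {}"
    using d by (auto simp: polygon_sides_iff)
  have "verts Q \<inter> beyond c d = {}"
  proof (rule ccontr)
    assume "\<not> ?thesis"
    then obtain y where y: "y \<in> verts Q" "y \<in> beyond c d" by blast
    then have y': "y \<in> beyond (\<not> b) e" using cd beyond_cover[OF ce(1), of y b] by auto
    have "d \<inter> beyond (\<not> b) e = {}" using cd(2) beyond_disjoint[OF ce(1), of _ "\<not> b"] by auto
    then obtain c' where c': "beyond (\<not> b) e \<union> e \<subseteq> beyond c' d \<union> d"
      using closed_side_subset[OF cd(1) ce(1)] by blast
    then have "c' = c" using y y' beyond_disjoint[OF cd(1) y(2)] by (cases "c' = c") auto
    then have "e \<subseteq> d" using c' cd(3) ce by auto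
    then show False using ce cd d(2) by (metis card_subset_eq card.infinite zero_neq_numeral)
  qed
  then show ?thesis using cd by (auto simp: polygon_sides_iff)
qed

lemma cells_half:
  assumes e: "e \<in> inner_edges Q"
  shows "cells (half b Q e) = {C \<in> cells Q. C \<inter> beyond (\<not> b) e = {}}"
proof (intro set_eqI iffI)
  have ce: "card e = 2" "e \<subseteq> verts Q" using inner_edge[OF e] by auto
  fix C assume C: "C \<in> cells (half b Q e)"
  then have sub: "C \<subseteq> verts (half b Q e)" and "3 \<le> card C"
    and sides: "polygon_sides C \<subseteq> polygon_sides (verts (half b Q e)) \<union> inner_edges (half b Q e)"
    and diags: "polygon_diagonals C \<inter> inner_edges (half b Q e) = {}"
    by (auto simp: cells_def)
  have off: "C \<inter> beyond (\<not> b) e = {}" using sub beyond_disjoint[OF ce(1), of _ "\<not> b"] by auto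
  have "polygon_sides C \<subseteq> polygon_sides (verts Q) \<union> inner_edges Q"
    using sides polygon_sides_half[OF e] e by auto
  moreover have "polygon_diagonals C \<inter> inner_edges Q = {}"
  proof (rule ccontr)
    assume "\<not> ?thesis"
    then obtain d where d: "d \<in> polygon_diagonals C" "d \<in> inner_edges Q" by blast
    have "C \<inter> beyond (\<not> b) d \<noteq> {}" "d \<subseteq> C" using d(1) by (auto simp: polygon_diagonals_iff)
    then have "d \<noteq> e" "d \<subseteq> verts (half b Q e)" using off sub by auto
    then show False using d diags by auto
  qed
  ultimately show "C \<in> {C \<in> cells Q. C \<inter> beyond (\<not> b) e = {}}"
    using off sub \<open>3 \<le> card C\<close> by (auto simp: cells_def)
next
  have ce: "card e = 2" "e \<subseteq> verts Q" using inner_edge[OF e] by auto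
  fix C assume "C \<in> {C \<in> cells Q. C \<inter> beyond (\<not> b) e = {}}"
  then have C: "C \<in> cells Q" and off: "C \<inter> beyond (\<not> b) e = {}" by auto
  have sub: "C \<subseteq> verts (half b Q e)" using off cell[OF C] beyond_cover[OF ce(1), of _ b] by auto
  have "d \<in> polygon_sides (verts (half b Q e)) \<union> inner_edges (half b Q e)"
    if d: "d \<in> polygon_sides C" for d
  proof -
    have d': "card d = 2" "d \<subseteq> C" using d by (auto simp: polygon_sides_iff)
    have "d \<in> polygon_sides (verts Q) \<or> d \<in> inner_edges Q" using C d by (auto simp: cells_def)
    moreover have "d \<in> polygon_sides (verts (half b Q e))" if "d \<in> polygon_sides (verts Q)"
      using that sub d' by (auto simp: polygon_sides_iff)
    moreover have "e \<in> polygon_sides (verts (half b Q e))"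
      using ce beyond_disjoint[OF ce(1), of _ "\<not> b"]
      unfolding polygon_sides_iff by (intro conjI exI[of _ "\<not> b"]) auto
    ultimately show ?thesis using sub d' by auto
  qed
  then show "C \<in> cells (half b Q e)"
    using C sub by (auto simp: cells_def)
qed

lemma dissected_polygon_half:
  assumes e: "e \<in> inner_edges Q"
  shows "dissected_polygon (half b Q e)"
proof
  show "inner_edges (half b Q e) \<subseteq> polygon_diagonals (verts (half b Q e))"
  proof
    fix d assume d: "d \<in> inner_edges (half b Q e)"
    then have "d \<notin> polygon_sides (verts Q)"
      using inner_edges_diagonals by (auto simp: polygon_diagonals_def)
    then have "d \<notin> polygon_sides (verts (half b Q e))"
      using polygon_sides_half[OF e] d by auto
    then show "d \<in> polygon_diagonals (verts (half b Q e))"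
      using d inner_edge[of d] by (auto simp: polygon_sides_iff polygon_diagonals_iff)
  qed
qed (use finite_verts noncrossing in auto)

lemma cell_in_half:
  assumes "C \<in> cells Q" and "e \<in> inner_edges Q"
  obtains b where "C \<in> cells (half b Q e)"
proof -
  obtain b where "C \<inter> beyond (\<not> b) e = {}" by (rule cell_on_one_side[OF assms])
  then have "C \<in> cells (half b Q e)" using assms by (simp add: cells_half)
  then show thesis by (rule that)
qed

lemma not_in_both_halves:
  assumes e: "e \<in> inner_edges Q" and "C \<in> cells (half b Q e)" "C \<in> cells (half (\<not> b) Q e)"
  shows False
proof -
  have C: "C \<in> cells Q" and off: "C \<inter> beyond (\<not> b) e = {}" "C \<inter> beyond b e = {}"
    using assms(2,3) unfolding cells_half[OF e] by simp_all
  have ce: "card e = 2" using inner_edge[OF e] by simp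
  have "C \<subseteq> e" using off beyond_cover[OF ce, of _ b] by blast
  moreover have "finite e" using ce by (simp add: card_ge_0_finite)
  ultimately have "card C \<le> card e" by (intro card_mono)
  then show False using cell[OF C] inner_edge[OF e] by auto
qed

lemma common_side_of_opposite_cells:
  assumes e: "e \<in> inner_edges Q" and "C \<in> cells (half b Q e)" "D \<in> cells (half (\<not> b) Q e)"
    and a: "a \<in> polygon_sides C" "a \<in> polygon_sides D"
  shows "a = e"
proof -
  have "C \<inter> beyond (\<not> b) e = {}" "D \<inter> beyond b e = {}"
    using assms(2,3) unfolding cells_half[OF e] by simp_all
  moreover have "a \<subseteq> C" "a \<subseteq> D" using a by (simp_all add: polygon_sides_iff)
  moreover have "card e = 2" using inner_edge[OF e] by simp
  ultimately have "a \<subseteq> e" using beyond_cover[of e _ b] by blast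
  then show ?thesis using a(1) inner_edge[OF e]
    by (metis card_subset_eq card.infinite polygon_sides_iff zero_neq_numeral)
qed

lemma unique_cell_at_open_edge:
  assumes e: "e \<in> inner_edges Q" and "C \<in> cells (half b Q e)" "D \<in> cells (half b Q e)"
    and "e \<in> polygon_sides C" "e \<in> polygon_sides D"
  shows "C = D"
  using assms unique_cell_at_edge[of C D e b] unfolding cells_half[OF e] polygon_sides_iff by auto

lemma at_most_two_cells_at_edge:
  assumes "d \<in> inner_edges Q" and "{C, C', C''} \<subseteq> cells Q"
    and "d \<in> polygon_sides C" "d \<in> polygon_sides C'" "d \<in> polygon_sides C''"
  shows "C = C' \<or> C = C'' \<or> C' = C''"
proof -
  have "\<exists>b. D \<in> cells (half b Q d)" if "D \<in> cells Q" for D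
    by (rule cell_in_half[OF that assms(1)]) blast
  then obtain b b' b'' where "C \<in> cells (half b Q d)" "C' \<in> cells (half b' Q d)"
    "C'' \<in> cells (half b'' Q d)" using assms(2) by (metis insert_subset)
  then show ?thesis using unique_cell_at_open_edge[OF assms(1)] assms(3-)
    by (cases b; cases b'; cases b'') auto
qed

end

section \<open>Paths of squares\<close>

lemma square_path_Nil: "square_path Q ss [] \<longleftrightarrow> (\<exists>s\<in>cells Q. ss = [s])"
  by (auto simp: square_path_def length_Suc_conv)

lemma square_path_nonempty: "square_path Q ss es \<Longrightarrow> ss \<noteq> []"
  by (auto simp: square_path_def)

lemma square_path_Cons:
  "square_path Q ss (a # es) \<longleftrightarrow> (\<exists>s ss'. ss = s # ss' \<and> s \<in> cells Q \<and> s \<notin> set ss' \<and>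
     a \<in> inner_edges Q \<and> a \<in> polygon_sides s \<and> a \<in> polygon_sides (hd ss') \<and>
     square_path Q ss' es)" (is "_ \<longleftrightarrow> ?R")
proof (cases ss)
  case Nil then show ?thesis by (simp add: square_path_def)
next
  case (Cons s ss')
  have "hd ss' = ss' ! 0" if "length ss' = Suc (length es)"
    using that by (cases ss') auto
  then show ?thesis unfolding Cons square_path_def
    by (auto simp: All_less_Suc2)
qed

lemma square_path_append:
  "square_path Q ss (es1 @ a # es2) \<longleftrightarrow> (\<exists>ss1 ss2. ss = ss1 @ ss2 \<and>
     square_path Q ss1 es1 \<and> square_path Q ss2 es2 \<and> set ss1 \<inter> set ss2 = {} \<and>
     a \<in> inner_edges Q \<and> a \<in> polygon_sides (last ss1) \<and> a \<in> polygon_sides (hd ss2))"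
proof (induction es1 arbitrary: ss)
  case Nil
  show ?case
  proof
    assume "square_path Q ss ([] @ a # es2)"
    then obtain s ss' where "ss = s # ss'" "s \<in> cells Q" "s \<notin> set ss'" "a \<in> inner_edges Q"
     "a \<in> polygon_sides s" "a \<in> polygon_sides (hd ss')" "square_path Q ss' es2"
      by (auto simp: square_path_Cons)
    then show "\<exists>ss1 ss2. ss = ss1 @ ss2 \<and>
     square_path Q ss1 [] \<and> square_path Q ss2 es2 \<and> set ss1 \<inter> set ss2 = {} \<and>
     a \<in> inner_edges Q \<and> a \<in> polygon_sides (last ss1) \<and> a \<in> polygon_sides (hd ss2)"
      by (intro exI[of _ "[s]"] exI[of _ ss']) (simp add: square_path_Nil)
  qed (auto simp: square_path_Cons square_path_Nil)
next
  case (Cons b es1)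
  show ?case
  proof
    assume "square_path Q ss ((b # es1) @ a # es2)"
    then obtain s ss' where s: "ss = s # ss'" "s \<in> cells Q" "s \<notin> set ss'" "b \<in> inner_edges Q"
     "b \<in> polygon_sides s" "b \<in> polygon_sides (hd ss')" "square_path Q ss' (es1 @ a # es2)"
      by (auto simp: square_path_Cons)
    then obtain ss1 ss2 where d: "ss' = ss1 @ ss2" "square_path Q ss1 es1" "square_path Q ss2 es2"
      "set ss1 \<inter> set ss2 = {}" "a \<in> inner_edges Q" "a \<in> polygon_sides (last ss1)"
      "a \<in> polygon_sides (hd ss2)" using Cons.IH by blast
    have "ss1 \<noteq> []" using d(2) by (rule square_path_nonempty)
    then show "\<exists>ss1 ss2. ss = ss1 @ ss2 \<and>
     square_path Q ss1 (b # es1) \<and> square_path Q ss2 es2 \<and> set ss1 \<inter> set ss2 = {} \<and>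
     a \<in> inner_edges Q \<and> a \<in> polygon_sides (last ss1) \<and> a \<in> polygon_sides (hd ss2)"
      using s d by (intro exI[of _ "s # ss1"] exI[of _ ss2]) (simp add: square_path_Cons)
  next
    assume "\<exists>ss1 ss2. ss = ss1 @ ss2 \<and>
     square_path Q ss1 (b # es1) \<and> square_path Q ss2 es2 \<and> set ss1 \<inter> set ss2 = {} \<and>
     a \<in> inner_edges Q \<and> a \<in> polygon_sides (last ss1) \<and> a \<in> polygon_sides (hd ss2)"
    then obtain s ss1 ss2 where d: "ss = s # ss1 @ ss2" "s \<in> cells Q" "s \<notin> set ss1"
      "b \<in> inner_edges Q" "b \<in> polygon_sides s" "b \<in> polygon_sides (hd ss1)"
      "square_path Q ss1 es1" "square_path Q ss2 es2"
      "set (s # ss1) \<inter> set ss2 = {}" "a \<in> inner_edges Q" "a \<in> polygon_sides (last (s # ss1))"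
      "a \<in> polygon_sides (hd ss2)" by (auto simp: square_path_Cons)
    have "ss1 \<noteq> []" using d(7) by (rule square_path_nonempty)
    then have "square_path Q (ss1 @ ss2) (es1 @ a # es2)" unfolding Cons.IH using d
      by (intro exI[of _ ss1] exI[of _ ss2]) simp
    then show "square_path Q ss ((b # es1) @ a # es2)"
      using d \<open>ss1 \<noteq> []\<close> by (simp add: square_path_Cons)
  qed
qed

lemma square_path_rev: "square_path Q ss es \<Longrightarrow> square_path Q (rev ss) (rev es)"
proof (induction es arbitrary: ss)
  case Nil then show ?case by (auto simp: square_path_Nil)
next
  case (Cons a es)
  then obtain s ss' where s: "ss = s # ss'" "s \<in> cells Q" "s \<notin> set ss'" "a \<in> inner_edges Q"
    "a \<in> polygon_sides s" "a \<in> polygon_sides (hd ss')" "square_path Q ss' es"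
    by (auto simp: square_path_Cons)
  have "ss' \<noteq> []" using s(7) by (rule square_path_nonempty)
  then show ?case using s Cons.IH[OF s(7)] unfolding s(1) rev.simps square_path_append
    by (intro exI[of _ "rev ss'"] exI[of _ "[s]"]) (simp add: square_path_Nil last_rev)
qed

lemma square_path_cells: "square_path Q ss es \<Longrightarrow> set ss \<subseteq> cells Q"
  and square_path_distinct: "square_path Q ss es \<Longrightarrow> distinct ss"
  by (simp_all add: square_path_def)

lemma square_path_ends: "square_path Q ss es \<Longrightarrow> hd ss \<in> cells Q \<and> last ss \<in> cells Q"
  using square_path_cells square_path_nonempty hd_in_set last_in_set by (metis subsetD)

lemma square_path_inner_edges: "square_path Q ss es \<Longrightarrow> set es \<subseteq> inner_edges Q"
  by (auto simp: square_path_def in_set_conv_nth)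

lemma square_path_hd_eq_last: "square_path Q ss es \<Longrightarrow> hd ss = last ss \<longleftrightarrow> es = []"
  by (cases es) (auto simp: square_path_Nil square_path_Cons dest: square_path_nonempty)

lemma right_angle_turns_rev: "right_angle_turns (rev es) \<longleftrightarrow> right_angle_turns es"
  unfolding right_angle_turns_def successively_rev by (simp add: Int_commute)

text \<open>
  Joining two open paths at \<open>e\<close> creates no new turn: the two turns at \<open>e\<close> are
  the last turns of the two open paths.
\<close>

lemma right_angle_turns_join:
  "right_angle_turns (es1 @ e # rev es2) \<longleftrightarrow>
     right_angle_turns (es1 @ [e]) \<and> right_angle_turns (es2 @ [e])"
proof -
  have "right_angle_turns (es2 @ [e]) \<longleftrightarrow> right_angle_turns (e # rev es2)"
    using right_angle_turns_rev[of "es2 @ [e]"] by simp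
  then show ?thesis unfolding right_angle_turns_def
    by (auto simp: successively_append_iff)
qed

context dissected_polygon
begin

text \<open>
  Such an edge would be a side of three distinct cells: the start and the two cells
  between which the path crosses it.
\<close>

lemma later_edge_not_side_of_start:
  assumes "square_path Q (s # ss) (a # es)" and "d \<in> set es"
  shows "d \<notin> polygon_sides s"
proof
  assume ds: "d \<in> polygon_sides s"
  have s: "s \<notin> set ss" "s \<in> cells Q" and path: "square_path Q ss es"
    using assms(1) by (auto simp: square_path_Cons)
  obtain i where i: "i < length es" "es ! i = d" using assms(2) by (auto simp: in_set_conv_nth)
  then have d: "d \<in> inner_edges Q" "d \<in> polygon_sides (ss ! i)" "d \<in> polygon_sides (ss ! Suc i)"
    and len: "Suc i < length ss" using path by (auto simp: square_path_def)
  then have in_ss: "ss ! i \<in> set ss" "ss ! Suc i \<in> set ss" "ss ! i \<noteq> ss ! Suc i"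
    using square_path_distinct[OF path] by (auto simp: nth_eq_iff_index_eq)
  have "{s, ss ! i, ss ! Suc i} \<subseteq> cells Q" using s in_ss square_path_cells[OF path] by blast
  then show False using at_most_two_cells_at_edge[OF d(1) _ ds d(2,3)] in_ss s by metis
qed

text \<open>
  Crossing \<open>d\<close> changes the side of \<open>d\<close>, crossing any other edge keeps it, and \<open>d\<close> cannot be crossed
  twice by a path of distinct cells.
\<close>

lemma square_path_side:
  assumes "square_path Q ss es" and "d \<in> inner_edges Q" and "hd ss \<in> cells (half b Q d)"
  shows "last ss \<in> cells (half (b \<longleftrightarrow> d \<notin> set es) Q d)"
  using assms
proof (induction es arbitrary: ss b)
  case Nil then show ?case by (auto simp: square_path_Nil)
next
  case (Cons a es)
  obtain s ss' where s: "ss = s # ss'" "s \<notin> set ss'" "a \<in> polygon_sides s"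
    "a \<in> polygon_sides (hd ss')" "square_path Q ss' es" using Cons.prems(1)
    by (auto simp: square_path_Cons)
  have ne: "ss' \<noteq> []" using s(5) by (rule square_path_nonempty)
  obtain c where c: "hd ss' \<in> cells (half c Q d)"
    using square_path_ends[OF s(5)] by (auto intro: cell_in_half[OF _ Cons.prems(2)])
  have hs: "s \<in> cells (half b Q d)" using Cons.prems(3) s(1) by simp
  have last: "last ss' \<in> cells (half (c \<longleftrightarrow> d \<notin> set es) Q d)"
    by (rule Cons.IH[OF s(5) Cons.prems(2) c])
  show ?case
  proof (cases "a = d")
    case True
    have "d \<notin> set es"
      using later_edge_not_side_of_start[of s ss' a es d] Cons.prems(1) s(1,3) True by auto
    moreover have "c = (\<not> b)"
    proof (rule ccontr)
      assume "c \<noteq> (\<not> b)"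
      then have "hd ss' = s"
        using unique_cell_at_open_edge[OF Cons.prems(2) c, of s] hs s(3,4) True by simp
      then show False using s(2) ne hd_in_set by metis
    qed
    ultimately show ?thesis using last ne s(1) True by simp
  next
    case False
    have "c = b"
    proof (rule ccontr)
      assume "c \<noteq> b"
      then have "c = (\<not> b)" by simp
      then have "a = d"
        using common_side_of_opposite_cells[OF Cons.prems(2) hs, of "hd ss'"] c s(3,4) by simp
      then show False using False by simp
    qed
    then show ?thesis using last ne s(1) False by simp
  qed
qed

definition separating_edges :: "square \<Rightarrow> square \<Rightarrow> edge set" where
  "separating_edges s t =
     {d \<in> inner_edges Q. \<forall>b. \<not> (s \<in> cells (half b Q d) \<and> t \<in> cells (half b Q d))}"

lemma separating_edges_commute: "separating_edges s t = separating_edges t s"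
  by (auto simp: separating_edges_def)

text \<open>
  The edges crossed by a path depend only on its ends. This is the uniqueness of paths in the
  tree of squares, as far as serpents can see it, and makes \<open>path_edges\<close> the edge set of any one route.
\<close>

lemma set_square_path:
  assumes path: "square_path Q ss es"
  shows "set es = separating_edges (hd ss) (last ss)"
proof (rule set_eqI)
  fix d
  show "d \<in> set es \<longleftrightarrow> d \<in> separating_edges (hd ss) (last ss)"
  proof (cases "d \<in> inner_edges Q")
    case False then show ?thesis using square_path_inner_edges[OF path]
      by (auto simp: separating_edges_def)
  next
    case True
    obtain b where b: "hd ss \<in> cells (half b Q d)"
      using square_path_ends[OF path] by (auto intro: cell_in_half[OF _ True])
    have last: "last ss \<in> cells (half (b \<longleftrightarrow> d \<notin> set es) Q d)"
      by (rule square_path_side[OF path True b])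
    show ?thesis
    proof (cases "d \<in> set es")
      case d: True
      have "\<not> (hd ss \<in> cells (half c Q d) \<and> last ss \<in> cells (half c Q d))" for c
        using not_in_both_halves[OF True] b last d by (cases "c = b") auto
      then show ?thesis using d True by (simp add: separating_edges_def)
    next
      case False
      then show ?thesis using b last by (auto simp: separating_edges_def)
    qed
  qed
qed

lemma square_path_half:
  assumes e: "e \<in> inner_edges Q"
  shows "square_path (half b Q e) ss es \<longleftrightarrow>
    square_path Q ss es \<and> hd ss \<in> cells (half b Q e) \<and> e \<notin> set es"
proof (induction es arbitrary: ss)
  case Nil show ?case by (auto simp: square_path_Nil cells_half[OF e])
next
  case (Cons a es)
  have next_cell: "t \<in> cells (half b Q e)"
    if t: "s \<in> cells (half b Q e)" "a \<in> polygon_sides s" "a \<in> polygon_sides t" "t \<in> cells Q" "a \<noteq> e"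
    for s t
  proof -
    obtain c where c: "t \<in> cells (half c Q e)" by (rule cell_in_half[OF t(4) e])
    show ?thesis
    proof (cases "c = b")
      case False
      then have "c = (\<not> b)" by simp
      then show ?thesis using common_side_of_opposite_cells[OF e t(1), of t a] c t by simp
    qed (use c in simp)
  qed
  have inner: "a \<in> inner_edges (half b Q e) \<longleftrightarrow> a \<in> inner_edges Q \<and> a \<noteq> e"
    if "s \<in> cells (half b Q e)" "a \<in> polygon_sides s" for s
  proof -
    have "a \<subseteq> s" "s \<subseteq> verts (half b Q e)"
      using that by (auto simp: polygon_sides_iff cells_def)
    then show ?thesis by auto
  qed
  have sub: "s \<in> cells Q" if "s \<in> cells (half b Q e)" for s using that by (simp add: cells_half[OF e])
  show ?case
  proof
    assume "square_path (half b Q e) ss (a # es)"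
    then obtain s ss' where s: "ss = s # ss'" "s \<in> cells (half b Q e)" "s \<notin> set ss'"
      "a \<in> inner_edges (half b Q e)" "a \<in> polygon_sides s" "a \<in> polygon_sides (hd ss')"
      "square_path (half b Q e) ss' es" unfolding square_path_Cons by blast
    then show "square_path Q ss (a # es) \<and> hd ss \<in> cells (half b Q e) \<and> e \<notin> set (a # es)"
      using Cons.IH inner[OF s(2,5)] sub[OF s(2)] by (auto simp: square_path_Cons)
  next
    assume R: "square_path Q ss (a # es) \<and> hd ss \<in> cells (half b Q e) \<and> e \<notin> set (a # es)"
    then obtain s ss' where s: "ss = s # ss'" "s \<in> cells (half b Q e)" "s \<notin> set ss'"
      "a \<in> inner_edges Q" "a \<in> polygon_sides s" "a \<in> polygon_sides (hd ss')"
      "square_path Q ss' es" by (auto simp: square_path_Cons)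
    have "hd ss' \<in> cells (half b Q e)"
      using next_cell[OF s(2,5,6)] square_path_ends[OF s(7)] R by auto
    then have "square_path (half b Q e) ss' es" using Cons.IH s(7) R by simp
    then show "square_path (half b Q e) ss (a # es)"
      using s inner[OF s(2,5)] R unfolding square_path_Cons by auto
  qed
qed

end

section \<open>Serpents and their routes\<close>

text \<open>
  The open edge only has to be recognisable: not an inner edge, and on the boundary of at most one
  cell. The value \<open>{}\<close> is then admissible for every dissection, and admits no open serpent, so that
  closed nests are a special case of open ones.
\<close>

locale open_dissection = dissected_polygon +
  fixes e :: edge
  assumes open_edge_not_inner: "e \<notin> inner_edges Q"
    and unique_cell_at_e: "\<lbrakk>C \<in> cells Q; D \<in> cells Q; e \<in> polygon_sides C; e \<in> polygon_sides D\<rbrakk> \<Longrightarrow> C = D"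
begin

abbreviation serpents :: "serpent set" where
  "serpents \<equiv> closed_serpents Q \<union> open_serpents Q e"

lemma path_edges_open:
  assumes path: "square_path Q ss es" and e: "e \<in> polygon_sides (last ss)"
  shows "path_edges Q (Open_Serpent (hd ss) e) = insert e (set es)"
proof -
  have "set es'' = insert e (set es)" if route: "route Q (Open_Serpent (hd ss) e) es''" for es''
  proof -
    obtain ss' es' where r: "square_path Q ss' es'" "hd ss' = hd ss" "e \<in> polygon_sides (last ss')"
      "es'' = es' @ [e]" using route by auto
    have "last ss' = last ss"
      using unique_cell_at_e r e square_path_ends[OF r(1)] square_path_ends[OF path] by blast
    then show ?thesis using set_square_path[OF path] set_square_path[OF r(1)] r by simp
  qed
  moreover have "route Q (Open_Serpent (hd ss) e) (es @ [e])" using path e by auto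
  ultimately show ?thesis unfolding path_edges_def by blast
qed

lemma open_serpentE:
  assumes "\<sigma> \<in> open_serpents Q e"
  obtains ss es where "\<sigma> = Open_Serpent (hd ss) e" "square_path Q ss es" "e \<in> polygon_sides (last ss)"
    "right_angle_turns (es @ [e])" "path_edges Q \<sigma> = insert e (set es)"
  using assms path_edges_open by (auto simp: open_serpents_def)

end

context dissected_polygon
begin

lemma path_edges_closed:
  assumes path: "square_path Q ss es" and "es \<noteq> []"
  shows "path_edges Q (Closed_Serpent {hd ss, last ss}) = set es"
proof -
  have "set es' = set es" if route: "route Q (Closed_Serpent {hd ss, last ss}) es'" for es'
  proof -
    obtain ss' where r: "square_path Q ss' es'" "{hd ss, last ss} = {hd ss', last ss'}"
      using route by auto
    then have "hd ss' = hd ss \<and> last ss' = last ss \<or> hd ss' = last ss \<and> last ss' = hd ss"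
      by (auto simp: doubleton_eq_iff)
    then show ?thesis using set_square_path[OF path] set_square_path[OF r(1)]
      separating_edges_commute by auto
  qed
  moreover have "route Q (Closed_Serpent {hd ss, last ss}) es"
    using path \<open>es \<noteq> []\<close> square_path_hd_eq_last[OF path] by auto
  ultimately show ?thesis unfolding path_edges_def by blast
qed

lemma closed_serpentE:
  assumes "\<sigma> \<in> closed_serpents Q" and "s \<in> extremities \<sigma>"
  obtains ss es where "\<sigma> = Closed_Serpent {s, last ss}" "hd ss = s" "s \<noteq> last ss" "es \<noteq> []"
    "square_path Q ss es" "right_angle_turns es" "path_edges Q \<sigma> = set es"
proof -
  obtain S es where S: "\<sigma> = Closed_Serpent S" "route Q (Closed_Serpent S) es" "right_angle_turns es"
    using assms(1) unfolding closed_serpents_def by blast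
  obtain ss where r: "square_path Q ss es" "hd ss \<noteq> last ss" "S = {hd ss, last ss}"
    using S(2) unfolding route.simps by blast
  have ne: "es \<noteq> []" using r square_path_hd_eq_last by blast
  have pe: "path_edges Q \<sigma> = set es" using path_edges_closed[OF r(1) ne] S(1) r(3) by simp
  consider "hd ss = s" | "last ss = s" using assms(2) S(1) r(3) by auto
  then show thesis
  proof cases
    case 1
    have "\<sigma> = Closed_Serpent {s, last ss}" "s \<noteq> last ss" using S(1) r 1 by auto
    then show thesis using 1 ne r(1) S(3) pe by (intro that[of ss es])
  next
    case 2
    have "ss \<noteq> []" using r(1) by (rule square_path_nonempty)
    then have ends: "hd (rev ss) = last ss" "last (rev ss) = hd ss" by (simp_all add: hd_rev last_rev)
    have "\<sigma> = Closed_Serpent {s, last (rev ss)}" "s \<noteq> last (rev ss)" "hd (rev ss) = s"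
      using S(1) r 2 ends by auto
    moreover have "rev es \<noteq> []" "right_angle_turns (rev es)" "path_edges Q \<sigma> = set (rev es)"
      using ne S(3) pe by (simp_all add: right_angle_turns_rev)
    ultimately show thesis using square_path_rev[OF r(1)] by (intro that[of "rev ss" "rev es"])
  qed
qed

lemma extremities_closed:
  assumes "\<sigma> \<in> closed_serpents Q"
  shows "extremities \<sigma> \<subseteq> cells Q" and "card (extremities \<sigma>) = 2"
    and "path_edges Q \<sigma> \<subseteq> inner_edges Q" and "is_closed \<sigma>"
proof -
  obtain S where S: "\<sigma> = Closed_Serpent S" "S \<noteq> {}"
    using assms by (auto simp: closed_serpents_def)
  then obtain s where "s \<in> extremities \<sigma>" by auto
  then obtain ss es where r: "\<sigma> = Closed_Serpent {s, last ss}" "hd ss = s" "s \<noteq> last ss"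
    "square_path Q ss es" "path_edges Q \<sigma> = set es"
    by (rule closed_serpentE[OF assms]) blast
  show "extremities \<sigma> \<subseteq> cells Q" "card (extremities \<sigma>) = 2" "is_closed \<sigma>"
    "path_edges Q \<sigma> \<subseteq> inner_edges Q"
    using r square_path_ends[OF r(4)] square_path_inner_edges[OF r(4)] by auto
qed

lemma finite_closed_serpents: "finite (closed_serpents Q)"
proof (rule finite_subset)
  show "closed_serpents Q \<subseteq> Closed_Serpent ` Pow (cells Q)"
  proof
    fix \<sigma> assume \<sigma>: "\<sigma> \<in> closed_serpents Q"
    then obtain S where "\<sigma> = Closed_Serpent S" by (auto simp: closed_serpents_def)
    then show "\<sigma> \<in> Closed_Serpent ` Pow (cells Q)" using extremities_closed(1)[OF \<sigma>] by simp
  qed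
  show "finite (Closed_Serpent ` Pow (cells Q))" using finite_cells by simp
qed

end

context open_dissection
begin

lemma extremities_open:
  assumes "\<sigma> \<in> open_serpents Q e"
  shows "extremities \<sigma> \<subseteq> cells Q" and "card (extremities \<sigma>) = 1" and "is_open \<sigma>"
proof -
  obtain ss es where r: "\<sigma> = Open_Serpent (hd ss) e" "square_path Q ss es"
    using assms by (rule open_serpentE) blast
  then show "extremities \<sigma> \<subseteq> cells Q" "card (extremities \<sigma>) = 1" "is_open \<sigma>"
    using square_path_ends[OF r(2)] by simp_all
qed

lemma finite_serpents: "finite serpents"
proof -
  have "open_serpents Q e \<subseteq> (\<lambda>s. Open_Serpent s e) ` cells Q"
  proof
    fix \<sigma> assume \<sigma>: "\<sigma> \<in> open_serpents Q e"
    then obtain s where "\<sigma> = Open_Serpent s e" unfolding open_serpents_def by blast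
    then show "\<sigma> \<in> (\<lambda>s. Open_Serpent s e) ` cells Q" using extremities_open(1)[OF \<sigma>] by simp
  qed
  then have "finite (open_serpents Q e)" by (rule finite_surj[OF finite_cells])
  then show ?thesis using finite_closed_serpents by simp
qed

lemma extremities_subset_cells: "\<sigma> \<in> serpents \<Longrightarrow> extremities \<sigma> \<subseteq> cells Q"
  using extremities_closed(1) extremities_open(1) by blast

section \<open>Ranks are determined by the pattern\<close>

text \<open>
  A serpent meets exactly one side of a square containing one of its extremities: by
  \<open>later_edge_not_side_of_start\<close> the path does not touch this square again, and if it ends on the open
  edge, it starts next to this edge only when it crosses nothing else.
\<close>

lemma unique_exit:
  assumes \<sigma>: "\<sigma> \<in> serpents" and s: "s \<in> extremities \<sigma>"
  shows "\<exists>!a. leaves_by Q \<sigma> s a"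
proof -
  have leaves: "leaves_by Q \<sigma> s a \<longleftrightarrow> a \<in> path_edges Q \<sigma> \<inter> polygon_sides s" for a
    using s by (auto simp: leaves_by_def)
  have first: "set (a # es) \<inter> polygon_sides (hd ss) = {a}"
    if path: "square_path Q ss (a # es)" for ss a es
  proof -
    obtain s ss' where s: "ss = s # ss'" "a \<in> polygon_sides s" using path
      by (auto simp: square_path_Cons)
    then show ?thesis using later_edge_not_side_of_start[of s ss' a es] path by auto
  qed
  from \<sigma> show ?thesis
  proof
    assume "\<sigma> \<in> closed_serpents Q"
    then obtain ss es where r: "hd ss = s" "es \<noteq> []" "square_path Q ss es"
      "path_edges Q \<sigma> = set es" using s by (rule closed_serpentE) blast
    then obtain a es' where "es = a # es'" by (cases es) auto
    then have "path_edges Q \<sigma> \<inter> polygon_sides s = {a}" using first[of ss a es'] r by simp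
    then show ?thesis unfolding leaves by simp
  next
    assume "\<sigma> \<in> open_serpents Q e"
    then obtain ss es where r: "\<sigma> = Open_Serpent (hd ss) e" "square_path Q ss es"
      "e \<in> polygon_sides (last ss)" "path_edges Q \<sigma> = insert e (set es)" by (rule open_serpentE) blast
    have hd: "hd ss = s" using r(1) s by simp
    show ?thesis
    proof (cases es)
      case Nil
      then have "hd ss = last ss" using square_path_hd_eq_last[OF r(2)] by simp
      then have "path_edges Q \<sigma> \<inter> polygon_sides s = {e}" using r hd Nil by auto
      then show ?thesis unfolding leaves by simp
    next
      case (Cons a es')
      then have "hd ss \<noteq> last ss" using square_path_hd_eq_last[OF r(2)] by simp
      then have "e \<notin> polygon_sides s"
        using unique_cell_at_e[OF _ _ _ r(3), of s] square_path_ends[OF r(2)] hd by auto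
      moreover have "set es \<inter> polygon_sides s = {a}" using first[of ss a es'] r hd Cons by simp
      ultimately have "path_edges Q \<sigma> \<inter> polygon_sides s = {a}" unfolding r(4) by blast
      then show ?thesis unfolding leaves by simp
    qed
  qed
qed

lemma sum_exits:
  assumes "\<sigma> \<in> serpents"
  shows "(\<Sum>s\<in>cells Q. \<Sum>a\<in>polygon_sides s. of_bool (leaves_by Q \<sigma> s a)) = card (extremities \<sigma>)"
proof -
  have "(\<Sum>a\<in>polygon_sides s. of_bool (leaves_by Q \<sigma> s a)) = (of_bool (s \<in> extremities \<sigma>) :: nat)"
    if s: "s \<in> cells Q" for s
  proof (cases "s \<in> extremities \<sigma>")
    case True
    then obtain a where a: "leaves_by Q \<sigma> s b \<longleftrightarrow> b = a" for b using unique_exit[OF assms] by metis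
    have "a \<in> polygon_sides s" using a[of a] by (simp add: leaves_by_def)
    then show ?thesis using True finite_polygon_sides[OF s] unfolding a of_bool_def by simp
  qed (simp add: leaves_by_def)
  then have "(\<Sum>s\<in>cells Q. \<Sum>a\<in>polygon_sides s. of_bool (leaves_by Q \<sigma> s a)) =
      (\<Sum>s\<in>cells Q. of_bool (s \<in> extremities \<sigma>) :: nat)" by simp
  also have "\<dots> = card (cells Q \<inter> extremities \<sigma>)"
    using finite_cells by (simp add: sum_of_bool_eq)
  also have "cells Q \<inter> extremities \<sigma> = extremities \<sigma>" using extremities_subset_cells[OF assms] by blast
  finally show ?thesis .
qed

text \<open>
  An open serpent reaches the open edge in the only square \<open>s\<close> next to it, either starting there, or
  turning towards \<open>e\<close> from exactly one side \<open>b\<close> of \<open>s\<close>. As it makes a right-angle turn, \<open>b\<close> meets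
  \<open>e\<close>, so this segment is recorded in the pattern.
\<close>

lemma sum_arrivals_at_open_edge:
  assumes "\<sigma> \<in> serpents"
  shows "(\<Sum>s | s \<in> cells Q \<and> e \<in> polygon_sides s. of_bool (leaves_by Q \<sigma> s e) +
      (\<Sum>b | b \<in> polygon_sides s \<and> b \<noteq> e \<and> b \<inter> e \<noteq> {}. of_bool (traverses Q \<sigma> s b e))) =
    (of_bool (is_open \<sigma>) :: nat)"
  using assms
proof
  assume \<sigma>: "\<sigma> \<in> closed_serpents Q"
  then have "e \<notin> path_edges Q \<sigma>" "is_closed \<sigma>"
    using extremities_closed[OF \<sigma>] open_edge_not_inner by auto
  then show ?thesis by (simp add: leaves_by_def traverses_def serpent.distinct_disc)
next
  assume "\<sigma> \<in> open_serpents Q e"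
  then obtain ss es where r: "\<sigma> = Open_Serpent (hd ss) e" "square_path Q ss es"
      "e \<in> polygon_sides (last ss)" "right_angle_turns (es @ [e])"
      "path_edges Q \<sigma> = insert e (set es)" by (rule open_serpentE) blast
  let ?t = "last ss"
  have t: "?t \<in> cells Q" using square_path_ends[OF r(2)] by simp
  have cells: "{s. s \<in> cells Q \<and> e \<in> polygon_sides s} = {?t}" using unique_cell_at_e r(3) t by blast
  have fin: "finite {b. b \<in> polygon_sides ?t \<and> b \<noteq> e \<and> b \<inter> e \<noteq> {}}"
    using finite_polygon_sides[OF t] by simp
  have "of_bool (leaves_by Q \<sigma> ?t e) +
      (\<Sum>b | b \<in> polygon_sides ?t \<and> b \<noteq> e \<and> b \<inter> e \<noteq> {}. of_bool (traverses Q \<sigma> ?t b e)) = (1 :: nat)"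
  proof (cases es rule: rev_cases)
    case Nil
    then have "hd ss = ?t" using square_path_hd_eq_last[OF r(2)] by simp
    then have "leaves_by Q \<sigma> ?t e" "\<not> traverses Q \<sigma> ?t b e" for b
      using r Nil by (auto simp: leaves_by_def traverses_def)
    then show ?thesis by simp
  next
    case (snoc es' a)
    have ne: "ss \<noteq> []" using r(2) by (rule square_path_nonempty)
    have rev: "square_path Q (rev ss) (a # rev es')" using square_path_rev[OF r(2)] snoc by simp
    then obtain ss' where ss': "rev ss = ?t # ss'" and at: "a \<in> polygon_sides ?t"
      using ne by (auto simp: square_path_Cons simp flip: hd_rev)
    then have others: "d \<notin> polygon_sides ?t" if "d \<in> set es'" for d
      using later_edge_not_side_of_start[OF rev[unfolded ss'], of d] that by simp
    have turn: "a \<inter> e \<noteq> {}" using r(4) snoc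
      by (auto simp: right_angle_turns_def successively_append_iff)
    have "a \<noteq> e" using square_path_inner_edges[OF r(2)] snoc open_edge_not_inner by auto
    then have "traverses Q \<sigma> ?t b e \<longleftrightarrow> b = a" for b
      using others at r(3,5) snoc by (auto simp: traverses_def)
    moreover have "\<not> leaves_by Q \<sigma> ?t e"
      using square_path_hd_eq_last[OF r(2)] snoc r(1) by (auto simp: leaves_by_def)
    ultimately show ?thesis using fin at turn \<open>a \<noteq> e\<close> by (simp add: of_bool_def)
  qed
  then show ?thesis unfolding cells using r(1) by simp
qed

lemma card_open_serpents_of_pattern:
  assumes "\<Sigma> \<subseteq> serpents"
  shows "card {\<sigma>\<in>\<Sigma>. is_open \<sigma>} =
    (\<Sum>s | s \<in> cells Q \<and> e \<in> polygon_sides s. card {\<sigma>\<in>\<Sigma>. leaves_by Q \<sigma> s e} +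
      (\<Sum>b | b \<in> polygon_sides s \<and> b \<noteq> e \<and> b \<inter> e \<noteq> {}. card {\<sigma>\<in>\<Sigma>. traverses Q \<sigma> s b e}))"
proof -
  have fin: "finite \<Sigma>" using assms finite_serpents by (rule finite_subset)
  have card: "card {\<sigma>\<in>\<Sigma>. P \<sigma>} = (\<Sum>\<sigma>\<in>\<Sigma>. of_bool (P \<sigma>))" for P
    using fin by (simp add: sum_of_bool_eq Collect_conj_eq)
  have "card {\<sigma>\<in>\<Sigma>. is_open \<sigma>} = (\<Sum>\<sigma>\<in>\<Sigma>. \<Sum>s | s \<in> cells Q \<and> e \<in> polygon_sides s.
      of_bool (leaves_by Q \<sigma> s e) +
      (\<Sum>b | b \<in> polygon_sides s \<and> b \<noteq> e \<and> b \<inter> e \<noteq> {}. of_bool (traverses Q \<sigma> s b e)))"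
    unfolding card using assms by (intro sum.cong refl) (simp add: sum_arrivals_at_open_edge subset_iff)
  also have "\<dots> = (\<Sum>s | s \<in> cells Q \<and> e \<in> polygon_sides s. \<Sum>\<sigma>\<in>\<Sigma>.
      of_bool (leaves_by Q \<sigma> s e) +
      (\<Sum>b | b \<in> polygon_sides s \<and> b \<noteq> e \<and> b \<inter> e \<noteq> {}. of_bool (traverses Q \<sigma> s b e)))"
    by (rule sum.swap)
  also have "\<dots> = (\<Sum>s | s \<in> cells Q \<and> e \<in> polygon_sides s. (\<Sum>\<sigma>\<in>\<Sigma>. of_bool (leaves_by Q \<sigma> s e)) +
      (\<Sum>b | b \<in> polygon_sides s \<and> b \<noteq> e \<and> b \<inter> e \<noteq> {}. \<Sum>\<sigma>\<in>\<Sigma>. of_bool (traverses Q \<sigma> s b e)))"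
    by (simp add: sum.distrib) (intro sum.cong refl sum.swap)
  finally show ?thesis unfolding card .
qed

lemma card_extremities_of_pattern:
  assumes "\<Sigma> \<subseteq> serpents"
  shows "2 * card {\<sigma>\<in>\<Sigma>. is_closed \<sigma>} + card {\<sigma>\<in>\<Sigma>. is_open \<sigma>} =
    (\<Sum>s\<in>cells Q. \<Sum>a\<in>polygon_sides s. card {\<sigma>\<in>\<Sigma>. leaves_by Q \<sigma> s a})"
proof -
  have fin: "finite \<Sigma>" using assms finite_serpents by (rule finite_subset)
  have card: "card {\<sigma>\<in>\<Sigma>. P \<sigma>} = (\<Sum>\<sigma>\<in>\<Sigma>. of_bool (P \<sigma>))" for P
    using fin by (simp add: sum_of_bool_eq Collect_conj_eq)
  have "card (extremities \<sigma>) = 2 * of_bool (is_closed \<sigma>) + of_bool (is_open \<sigma>)"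
    if "\<sigma> \<in> serpents" for \<sigma>
    using that
  proof
    assume \<sigma>: "\<sigma> \<in> closed_serpents Q"
    show ?thesis using extremities_closed(2,4)[OF \<sigma>] by (cases \<sigma>) auto
  next
    assume \<sigma>: "\<sigma> \<in> open_serpents Q e"
    show ?thesis using extremities_open(2,3)[OF \<sigma>] by (cases \<sigma>) auto
  qed
  then have "2 * card {\<sigma>\<in>\<Sigma>. is_closed \<sigma>} + card {\<sigma>\<in>\<Sigma>. is_open \<sigma>} =
      (\<Sum>\<sigma>\<in>\<Sigma>. card (extremities \<sigma>))"
    unfolding card sum_distrib_left sum.distrib[symmetric] using assms
    by (intro sum.cong refl) auto
  also have "\<dots> = (\<Sum>\<sigma>\<in>\<Sigma>. \<Sum>s\<in>cells Q. \<Sum>a\<in>polygon_sides s. of_bool (leaves_by Q \<sigma> s a))"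
    using assms by (intro sum.cong refl) (simp add: sum_exits subset_iff)
  also have "\<dots> = (\<Sum>s\<in>cells Q. \<Sum>\<sigma>\<in>\<Sigma>. \<Sum>a\<in>polygon_sides s. of_bool (leaves_by Q \<sigma> s a))"
    by (rule sum.swap)
  also have "\<dots> = (\<Sum>s\<in>cells Q. \<Sum>a\<in>polygon_sides s. \<Sum>\<sigma>\<in>\<Sigma>. of_bool (leaves_by Q \<sigma> s a))"
    by (intro sum.cong refl sum.swap)
  finally show ?thesis unfolding card .
qed

text \<open>
  The arrivals at the open edge give the number of open serpents. As closed serpents have two
  extremities and open ones a single one, the number of extremities then gives the number of closed serpents.
\<close>

lemma same_pattern_same_ranks:
  assumes "\<Sigma> \<subseteq> serpents" "T \<subseteq> serpents" and same: "same_pattern Q \<Sigma> T"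
  shows "card {\<sigma>\<in>\<Sigma>. is_open \<sigma>} = card {\<sigma>\<in>T. is_open \<sigma>}"
    and "card {\<sigma>\<in>\<Sigma>. is_closed \<sigma>} = card {\<sigma>\<in>T. is_closed \<sigma>}"
proof -
  have leaves: "card {\<sigma>\<in>\<Sigma>. leaves_by Q \<sigma> s a} = card {\<sigma>\<in>T. leaves_by Q \<sigma> s a}"
    if "s \<in> cells Q" "a \<in> polygon_sides s" for s a
    using same that by (simp add: same_pattern_def)
  have traverses: "card {\<sigma>\<in>\<Sigma>. traverses Q \<sigma> s b e} = card {\<sigma>\<in>T. traverses Q \<sigma> s b e}"
    if "s \<in> cells Q" "b \<in> polygon_sides s" "e \<in> polygon_sides s" "b \<noteq> e" "b \<inter> e \<noteq> {}" for s b
    using same that by (simp add: same_pattern_def)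
  show op: "card {\<sigma>\<in>\<Sigma>. is_open \<sigma>} = card {\<sigma>\<in>T. is_open \<sigma>}"
    unfolding card_open_serpents_of_pattern[OF assms(1)] card_open_serpents_of_pattern[OF assms(2)]
    by (intro sum.cong refl arg_cong2[of _ _ _ _ "(+)"]) (auto simp: leaves traverses)
  have "2 * card {\<sigma>\<in>\<Sigma>. is_closed \<sigma>} + card {\<sigma>\<in>\<Sigma>. is_open \<sigma>} =
      2 * card {\<sigma>\<in>T. is_closed \<sigma>} + card {\<sigma>\<in>T. is_open \<sigma>}"
    unfolding card_extremities_of_pattern[OF assms(1)] card_extremities_of_pattern[OF assms(2)]
    by (intro sum.cong refl) (simp add: leaves)
  then show "card {\<sigma>\<in>\<Sigma>. is_closed \<sigma>} = card {\<sigma>\<in>T. is_closed \<sigma>}" using op by simp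
qed

definition representatives :: "serpent set set" where
  "representatives = {\<Sigma>. \<Sigma> \<subseteq> serpents \<and> compatible Q \<Sigma>}"

definition pattern_rel :: "serpent set rel" where
  "pattern_rel = {(\<Sigma>, T). \<Sigma> \<in> representatives \<and> T \<in> representatives \<and> same_pattern Q \<Sigma> T}"

lemma open_serpent_nests_eq: "open_serpent_nests Q e = representatives // pattern_rel"
  unfolding open_serpent_nests_def nests_of_def representatives_def pattern_rel_def
  by (simp add: conj_assoc)

lemma equiv_pattern_rel: "equiv representatives pattern_rel"
proof (rule equivI)
  show "pattern_rel \<subseteq> representatives \<times> representatives" by (auto simp: pattern_rel_def)
  show "refl_on representatives pattern_rel"
    by (simp add: refl_on_def pattern_rel_def same_pattern_def)
  show "sym pattern_rel" by (rule symI) (simp add: pattern_rel_def same_pattern_def)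
  show "trans pattern_rel" by (rule transI) (simp add: pattern_rel_def same_pattern_def)
qed

lemma finite_nests: "finite (representatives // pattern_rel)"
proof (rule finite_quotient)
  show "finite representatives"
    by (rule finite_subset[of _ "Pow serpents"])
      (simp add: representatives_def Collect_mono Pow_def, simp add: finite_serpents del: finite_Un)
  show "pattern_rel \<subseteq> representatives \<times> representatives" by (auto simp: pattern_rel_def)
qed

lemma ranks_of_class:
  assumes "\<Sigma> \<in> representatives"
  shows "rk (pattern_rel `` {\<Sigma>}) = card {\<sigma>\<in>\<Sigma>. is_closed \<sigma>}"
    and "op_rk (pattern_rel `` {\<Sigma>}) = card {\<sigma>\<in>\<Sigma>. is_open \<sigma>}"
proof -
  have self: "\<Sigma> \<in> pattern_rel `` {\<Sigma>}" using assms by (simp add: pattern_rel_def same_pattern_def)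
  have eq: "card {\<sigma>\<in>T. is_closed \<sigma>} = card {\<sigma>\<in>\<Sigma>. is_closed \<sigma>}"
    "card {\<sigma>\<in>T. is_open \<sigma>} = card {\<sigma>\<in>\<Sigma>. is_open \<sigma>}" if "T \<in> pattern_rel `` {\<Sigma>}" for T
  proof -
    have "\<Sigma> \<subseteq> serpents" "T \<subseteq> serpents" "same_pattern Q \<Sigma> T"
      using that by (simp_all add: pattern_rel_def representatives_def)
    from same_pattern_same_ranks[OF this] show "card {\<sigma>\<in>T. is_closed \<sigma>} = card {\<sigma>\<in>\<Sigma>. is_closed \<sigma>}"
      "card {\<sigma>\<in>T. is_open \<sigma>} = card {\<sigma>\<in>\<Sigma>. is_open \<sigma>}" by simp_all
  qed
  show "rk (pattern_rel `` {\<Sigma>}) = card {\<sigma>\<in>\<Sigma>. is_closed \<sigma>}"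
    unfolding rk_def by (rule the_elem_image_unique) (use self eq(1) in blast)+
  show "op_rk (pattern_rel `` {\<Sigma>}) = card {\<sigma>\<in>\<Sigma>. is_open \<sigma>}"
    unfolding op_rk_def by (rule the_elem_image_unique) (use self eq(2) in blast)+
qed

end

section \<open>Serpents crossing an inner edge\<close>

text \<open>
  Three open dissections are at hand: the two sides \<open>half b Q e\<close> with open edge \<open>e\<close>, and \<open>Q\<close>
  itself with the dummy open edge \<open>{}\<close>, whose nests are the closed nests of \<open>Q\<close>.
\<close>

locale inner_cut = dissected_polygon +
  fixes e :: edge
  assumes e: "e \<in> inner_edges Q"
begin

sublocale part: open_dissection "half b Q e" e for b
proof -
  interpret h: dissected_polygon "half b Q e" by (rule dissected_polygon_half[OF e])
  show "open_dissection (half b Q e) e"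
    by unfold_locales (simp, rule unique_cell_at_open_edge[OF e])
qed

sublocale whole: open_dissection Q "{}"
  by unfold_locales (use inner_edge[of "{}"] in \<open>auto simp: polygon_sides_iff\<close>)

abbreviation side :: "bool \<Rightarrow> square set" where
  "side b \<equiv> cells (half b Q e)"

lemma side_cases:
  assumes "s \<in> cells Q"
  shows "s \<in> side b \<or> s \<in> side (\<not> b)"
proof -
  obtain c where "s \<in> side c" by (rule cell_in_half[OF assms e])
  then show ?thesis by (cases "c = b") auto
qed

lemma side_disjoint: "s \<in> side b \<Longrightarrow> s \<notin> side (\<not> b)"
  using not_in_both_halves[OF e] by blast

lemma side_subset: "side b \<subseteq> cells Q"
  by (auto simp: cells_half[OF e])

text \<open>
  Both partial paths are directed towards \<open>e\<close>, like open serpents, so the second one has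
  to be reversed.
\<close>

lemma square_path_across:
  assumes p1: "square_path (half b Q e) ss1 es1" and p2: "square_path (half (\<not> b) Q e) ss2 es2"
    and e1: "e \<in> polygon_sides (last ss1)" and e2: "e \<in> polygon_sides (last ss2)"
  shows "square_path Q (ss1 @ rev ss2) (es1 @ e # rev es2)"
proof -
  have "set ss1 \<subseteq> side b" "set ss2 \<subseteq> side (\<not> b)" using p1 p2 square_path_cells by blast+
  then have "set ss1 \<inter> set (rev ss2) = {}" using side_disjoint by auto
  moreover have "square_path Q ss1 es1" "square_path Q (rev ss2) (rev es2)"
    using p1 p2 square_path_rev by (auto simp: square_path_half[OF e])
  moreover have "hd (rev ss2) = last ss2" using square_path_nonempty[OF p2] by (simp add: hd_rev)
  ultimately show ?thesis unfolding square_path_append using e e1 e2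
    by (intro exI[of _ ss1] exI[of _ "rev ss2"]) simp
qed

lemma square_path_across_cases:
  assumes p: "square_path Q ss es" and hd: "hd ss \<in> side b" and last: "last ss \<in> side (\<not> b)"
  obtains ss1 es1 ss2 es2 where "square_path (half b Q e) ss1 es1" "square_path (half (\<not> b) Q e) ss2 es2"
    "e \<in> polygon_sides (last ss1)" "e \<in> polygon_sides (last ss2)"
    "hd ss1 = hd ss" "hd ss2 = last ss" "es = es1 @ e # rev es2"
proof -
  have "e \<in> set es" using square_path_side[OF p e hd] side_disjoint[OF last] by (cases "e \<in> set es") auto
  then obtain es1 es2 where es: "es = es1 @ e # es2" "e \<notin> set es1" by (metis split_list_first)
  obtain ss1 ss2 where ss: "ss = ss1 @ ss2" "square_path Q ss1 es1" "square_path Q ss2 es2"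
    "set ss1 \<inter> set ss2 = {}" "e \<in> polygon_sides (last ss1)" "e \<in> polygon_sides (hd ss2)"
    using p unfolding es(1) square_path_append by blast
  have ne: "ss1 \<noteq> []" "ss2 \<noteq> []" using ss(2,3) square_path_nonempty by blast+
  have hd1: "hd ss1 \<in> side b" using hd ss(1) ne by simp
  have last1: "last ss1 \<in> side b" using square_path_side[OF ss(2) e hd1] es(2) by simp
  have "hd ss2 \<noteq> last ss1" using ss(4) ne by (metis disjoint_iff hd_in_set last_in_set)
  then have "hd ss2 \<notin> side b" using unique_cell_at_open_edge[OF e last1] ss(5,6) by metis
  then have hd2: "hd ss2 \<in> side (\<not> b)" using side_cases square_path_ends[OF ss(3)] by blast
  have last2: "last ss2 \<in> side (\<not> b)" using last ss(1) ne by simp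
  have es2: "e \<notin> set es2"
    using square_path_side[OF ss(3) e hd2] side_disjoint[OF last2] by (cases "e \<in> set es2") auto
  have rev: "hd (rev ss2) = last ss2" "last (rev ss2) = hd ss2" using ne by (simp_all add: hd_rev last_rev)
  show thesis
  proof (rule that[of ss1 es1 "rev ss2" "rev es2"])
    show "square_path (half b Q e) ss1 es1" using ss(2) hd1 es(2) by (simp add: square_path_half[OF e])
    show "square_path (half (\<not> b) Q e) (rev ss2) (rev es2)"
      using square_path_rev[OF ss(3)] rev last2 es2 by (simp add: square_path_half[OF e])
  qed (use ss es rev ne in simp_all)
qed

lemma crossing_serpentE:
  assumes \<sigma>: "\<sigma> \<in> closed_serpents Q" and s: "s \<in> extremities \<sigma>" "s \<in> side b"
    and cross: "\<not> extremities \<sigma> \<subseteq> side b"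
  obtains t where "\<sigma> = Closed_Serpent {s, t}" "t \<in> side (\<not> b)"
    "Open_Serpent s e \<in> open_serpents (half b Q e) e"
    "Open_Serpent t e \<in> open_serpents (half (\<not> b) Q e) e"
    "path_edges Q \<sigma> = path_edges (half b Q e) (Open_Serpent s e) \<union>
       path_edges (half (\<not> b) Q e) (Open_Serpent t e)"
proof -
  obtain ss es where r: "\<sigma> = Closed_Serpent {s, last ss}" "hd ss = s"
    "square_path Q ss es" "right_angle_turns es" "path_edges Q \<sigma> = set es"
    using \<sigma> s(1) by (rule closed_serpentE) blast
  have hd: "hd ss \<in> side b" using r(2) s(2) by simp
  have "last ss \<notin> side b" using cross r(1) s(2) by simp
  then have last: "last ss \<in> side (\<not> b)" using side_cases square_path_ends[OF r(3)] by blast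
  obtain ss1 es1 ss2 es2 where c: "square_path (half b Q e) ss1 es1"
    "square_path (half (\<not> b) Q e) ss2 es2"
    "e \<in> polygon_sides (last ss1)" "e \<in> polygon_sides (last ss2)"
    "hd ss1 = hd ss" "hd ss2 = last ss" "es = es1 @ e # rev es2"
    by (rule square_path_across_cases[OF r(3) hd last])
  have turns: "right_angle_turns (es1 @ [e])" "right_angle_turns (es2 @ [e])"
    using r(4) unfolding c(7) right_angle_turns_join by simp_all
  have pe: "path_edges (half b Q e) (Open_Serpent s e) = insert e (set es1)"
    "path_edges (half (\<not> b) Q e) (Open_Serpent (last ss) e) = insert e (set es2)"
    using part.path_edges_open[OF c(1,3)] part.path_edges_open[OF c(2,4)] c(5,6) r(2) by simp_all
  have "route (half b Q e) (Open_Serpent s e) (es1 @ [e])"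
    unfolding route.simps using c r(2) by blast
  then have 1: "Open_Serpent s e \<in> open_serpents (half b Q e) e"
    using turns unfolding open_serpents_def by blast
  have "route (half (\<not> b) Q e) (Open_Serpent (last ss) e) (es2 @ [e])"
    unfolding route.simps using c by blast
  then have 2: "Open_Serpent (last ss) e \<in> open_serpents (half (\<not> b) Q e) e"
    using turns unfolding open_serpents_def by blast
  show thesis
    by (rule that[OF r(1) last 1 2]) (simp add: pe r(5) c(7))
qed

lemma joined_serpent:
  assumes "Open_Serpent s e \<in> open_serpents (half b Q e) e"
    and "Open_Serpent t e \<in> open_serpents (half (\<not> b) Q e) e"
  shows "Closed_Serpent {s, t} \<in> closed_serpents Q"
proof -
  obtain ss1 es1 where 1: "Open_Serpent s e = Open_Serpent (hd ss1) e" "square_path (half b Q e) ss1 es1"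
    "e \<in> polygon_sides (last ss1)" "right_angle_turns (es1 @ [e])"
    using assms(1) by (rule part.open_serpentE) blast
  obtain ss2 es2 where 2: "Open_Serpent t e = Open_Serpent (hd ss2) e"
    "square_path (half (\<not> b) Q e) ss2 es2"
    "e \<in> polygon_sides (last ss2)" "right_angle_turns (es2 @ [e])"
    using assms(2) by (rule part.open_serpentE) blast
  let ?ss = "ss1 @ rev ss2" and ?es = "es1 @ e # rev es2"
  have path: "square_path Q ?ss ?es" by (rule square_path_across[OF 1(2) 2(2) 1(3) 2(3)])
  have ne: "ss1 \<noteq> []" "ss2 \<noteq> []" using 1(2) 2(2) square_path_nonempty by blast+
  then have ends: "hd ?ss = s" "last ?ss = t" using 1(1) 2(1) by (simp_all add: last_rev)
  have "hd ?ss \<noteq> last ?ss" using square_path_hd_eq_last[OF path] by simp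
  then have "route Q (Closed_Serpent {s, t}) ?es"
    unfolding route.simps using path ends by (intro exI[of _ ?ss]) simp
  moreover have "right_angle_turns ?es" using 1(4) 2(4) by (simp add: right_angle_turns_join)
  ultimately show ?thesis unfolding closed_serpents_def by blast
qed

text \<open>
  A path whose ends lie on one side of \<open>e\<close> does not cross \<open>e\<close>, so it never leaves this side.
\<close>

lemma route_half:
  assumes "S \<subseteq> side b"
  shows "route (half b Q e) (Closed_Serpent S) = route Q (Closed_Serpent S)"
proof -
  have "square_path (half b Q e) ss es \<longleftrightarrow> square_path Q ss es"
    if "hd ss \<in> side b" "last ss \<in> side b" for ss es
    using square_path_side[of ss es e b] side_disjoint[OF that(2)] that e
    by (cases "e \<in> set es") (auto simp: square_path_half[OF e])
  then have "square_path (half b Q e) ss es \<and> hd ss \<noteq> last ss \<and> S = {hd ss, last ss} \<longleftrightarrow>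
      square_path Q ss es \<and> hd ss \<noteq> last ss \<and> S = {hd ss, last ss}" for ss es
    using assms by (metis insert_subset)
  then show ?thesis by (simp add: fun_eq_iff)
qed

lemma closed_serpents_half:
  "\<sigma> \<in> closed_serpents (half b Q e) \<longleftrightarrow> \<sigma> \<in> closed_serpents Q \<and> extremities \<sigma> \<subseteq> side b"
proof -
  have "Closed_Serpent S \<in> closed_serpents (half b Q e) \<longleftrightarrow> Closed_Serpent S \<in> closed_serpents Q"
    if "S \<subseteq> side b" for S
    using route_half[OF that] by (simp add: closed_serpents_def del: route.simps)
  moreover have "\<exists>S. \<sigma> = Closed_Serpent S" if "\<sigma> \<in> closed_serpents R" for R
    using that unfolding closed_serpents_def by blast
  ultimately show ?thesis using part.extremities_closed(1)[of \<sigma> b] by (metis extremities.simps(1))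
qed

lemma path_edges_half:
  "\<sigma> \<in> closed_serpents (half b Q e) \<Longrightarrow> path_edges (half b Q e) \<sigma> = path_edges Q \<sigma>"
proof -
  assume \<sigma>: "\<sigma> \<in> closed_serpents (half b Q e)"
  then obtain S where S: "\<sigma> = Closed_Serpent S" unfolding closed_serpents_def by blast
  then have "S \<subseteq> side b" using part.extremities_closed(1)[OF \<sigma>] by simp
  then show ?thesis unfolding path_edges_def S by (simp only: route_half)
qed

section \<open>Pieces of a serpent on the two sides\<close>

definition meets :: "bool \<Rightarrow> serpent \<Rightarrow> bool" where
  "meets b \<sigma> \<longleftrightarrow> extremities \<sigma> \<inter> side b \<noteq> {}"

text \<open>
  For a serpent crossing \<open>e\<close> exactly one extremity lies on side \<open>b\<close>, and the piece starts there.
  The definition is only meant for serpents with \<open>meets b \<sigma>\<close>.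
\<close>

definition piece :: "bool \<Rightarrow> serpent \<Rightarrow> serpent" where
  "piece b \<sigma> = (if extremities \<sigma> \<subseteq> side b then \<sigma>
     else Open_Serpent (the_elem (extremities \<sigma> \<inter> side b)) e)"

lemma piece_cases:
  assumes \<sigma>: "\<sigma> \<in> closed_serpents Q" and m: "meets b \<sigma>"
  obtains (inside) "\<sigma> \<in> closed_serpents (half b Q e)" "extremities \<sigma> \<subseteq> side b" "piece b \<sigma> = \<sigma>"
  | (across) s t where "\<sigma> = Closed_Serpent {s, t}" "s \<in> side b" "t \<in> side (\<not> b)"
    "Open_Serpent s e \<in> open_serpents (half b Q e) e"
    "Open_Serpent t e \<in> open_serpents (half (\<not> b) Q e) e"
    "path_edges Q \<sigma> = path_edges (half b Q e) (Open_Serpent s e) \<union>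
       path_edges (half (\<not> b) Q e) (Open_Serpent t e)"
    "piece b \<sigma> = Open_Serpent s e" "meets (\<not> b) \<sigma>"
proof (cases "extremities \<sigma> \<subseteq> side b")
  case True
  then show thesis using inside \<sigma> closed_serpents_half by (simp add: piece_def)
next
  case False
  obtain s where s: "s \<in> extremities \<sigma>" "s \<in> side b" using m by (auto simp: meets_def)
  obtain t where t: "\<sigma> = Closed_Serpent {s, t}" "t \<in> side (\<not> b)"
    "Open_Serpent s e \<in> open_serpents (half b Q e) e"
    "Open_Serpent t e \<in> open_serpents (half (\<not> b) Q e) e"
    "path_edges Q \<sigma> = path_edges (half b Q e) (Open_Serpent s e) \<union>
       path_edges (half (\<not> b) Q e) (Open_Serpent t e)"
    by (rule crossing_serpentE[OF \<sigma> s False])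
  have "t \<notin> side b" using side_disjoint[of t "\<not> b"] t(2) by simp
  then have "extremities \<sigma> \<inter> side b = {s}" using t(1) s(2) by auto
  then have "piece b \<sigma> = Open_Serpent s e" using False by (simp add: piece_def)
  moreover have "meets (\<not> b) \<sigma>" using t(1,2) by (auto simp: meets_def)
  ultimately show thesis using across t s(2) by blast
qed

lemma piece_in_serpents: "\<sigma> \<in> closed_serpents Q \<Longrightarrow> meets b \<sigma> \<Longrightarrow> piece b \<sigma> \<in> part.serpents b"
  by (erule (1) piece_cases) simp_all

lemma extremities_piece:
  assumes "\<sigma> \<in> closed_serpents Q" and "meets b \<sigma>" and s: "s \<in> side b"
  shows "s \<in> extremities (piece b \<sigma>) \<longleftrightarrow> s \<in> extremities \<sigma>"
  using assms(1,2)
proof (cases rule: piece_cases)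
  case (across s' t)
  then have "s \<noteq> t" using side_disjoint[OF s] by blast
  then show ?thesis using across by simp
qed simp

lemma is_open_piece:
  assumes "\<sigma> \<in> closed_serpents Q" and "meets b \<sigma>"
  shows "is_open (piece b \<sigma>) \<longleftrightarrow> meets (\<not> b) \<sigma>"
  using assms
proof (cases rule: piece_cases)
  case inside
  then have "\<not> meets (\<not> b) \<sigma>" using side_disjoint by (auto simp: meets_def)
  moreover have "is_closed \<sigma>" using assms(1) by (rule extremities_closed)
  ultimately show ?thesis using inside serpent.distinct_disc by metis
qed simp

text \<open>
  From a square on side \<open>b\<close> nothing of the other side is visible but the edge \<open>e\<close>,
  and only an open serpent reaches \<open>e\<close>.
\<close>

lemma foreign_path_edge:
  assumes "s \<in> side b" "a \<in> polygon_sides s"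
    and "\<sigma> \<in> part.serpents (\<not> b)" "a \<in> path_edges (half (\<not> b) Q e) \<sigma>"
  shows "a = e" and "is_open \<sigma>"
proof -
  have notin: "a \<notin> inner_edges (half (\<not> b) Q e)"
  proof
    assume a: "a \<in> inner_edges (half (\<not> b) Q e)"
    have "a \<subseteq> beyond (\<not> b) e \<union> e" "a \<noteq> e" using a by auto
    moreover have "s \<inter> beyond (\<not> b) e = {}" using assms(1) by (simp add: cells_half[OF e])
    moreover have card: "a \<subseteq> s" "card a = 2" using assms(2) by (simp_all add: polygon_sides_iff)
    ultimately have "a \<subseteq> e" by blast
    moreover have "card e = 2" using inner_edge[OF e] by simp
    moreover have "finite e" using \<open>card e = 2\<close> by (simp add: card_ge_0_finite)
    ultimately have "a = e" using card(2) by (simp add: card_subset_eq)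
    then show False using \<open>a \<noteq> e\<close> by simp
  qed
  from assms(3) have "a = e \<and> is_open \<sigma>"
  proof
    assume \<sigma>: "\<sigma> \<in> closed_serpents (half (\<not> b) Q e)"
    show ?thesis using part.extremities_closed(3)[OF \<sigma>] notin assms(4) by blast
  next
    assume \<sigma>: "\<sigma> \<in> open_serpents (half (\<not> b) Q e) e"
    then obtain ss es where "square_path (half (\<not> b) Q e) ss es"
      "path_edges (half (\<not> b) Q e) \<sigma> = insert e (set es)" by (rule part.open_serpentE) blast
    then have "a = e" using assms(4) square_path_inner_edges notin by blast
    then show ?thesis using part.extremities_open(3)[OF \<sigma>] by simp
  qed
  then show "a = e" "is_open \<sigma>" by simp_all
qed

text \<open>
  A square sees of a serpent exactly what it sees of its piece. For a crossing serpent the piece on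
  the other side could contribute only \<open>e\<close>, which the piece on this side reaches as well.
\<close>

lemma path_edges_piece:
  assumes \<sigma>: "\<sigma> \<in> closed_serpents Q" and s: "s \<in> side b" and a: "a \<in> polygon_sides s"
  shows "a \<in> path_edges Q \<sigma> \<longleftrightarrow> meets b \<sigma> \<and> a \<in> path_edges (half b Q e) (piece b \<sigma>)"
proof (cases "meets b \<sigma>")
  case True
  from \<sigma> True show ?thesis
  proof (cases rule: piece_cases)
    case inside
    then show ?thesis using True path_edges_half by simp
  next
    case (across s' t)
    have "e \<in> path_edges (half b Q e) (Open_Serpent s' e)"
      using across(4) by (rule part.open_serpentE) simp
    moreover have "a = e" if "a \<in> path_edges (half (\<not> b) Q e) (Open_Serpent t e)"
      using foreign_path_edge(1)[OF s a _ that] across(5) by simp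
    ultimately show ?thesis using across True by auto
  qed
next
  case False
  have "extremities \<sigma> \<subseteq> side (\<not> b)"
    using False extremities_closed(1)[OF \<sigma>] side_cases unfolding meets_def by blast
  then have c: "\<sigma> \<in> closed_serpents (half (\<not> b) Q e)" using \<sigma> closed_serpents_half by simp
  then have "a \<notin> path_edges Q \<sigma>"
    using foreign_path_edge(2)[OF s a, of \<sigma>] path_edges_half[OF c] extremities_closed(4)[OF \<sigma>]
      serpent.distinct_disc by auto
  then show ?thesis using False by simp
qed

lemma leaves_by_piece:
  assumes "\<sigma> \<in> closed_serpents Q" and "s \<in> side b"
  shows "leaves_by Q \<sigma> s a \<longleftrightarrow> meets b \<sigma> \<and> leaves_by (half b Q e) (piece b \<sigma>) s a"
  using path_edges_piece[OF assms, of a] extremities_piece[OF assms(1) _ assms(2)]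
  unfolding leaves_by_def by blast

lemma traverses_piece:
  assumes "\<sigma> \<in> closed_serpents Q" and "s \<in> side b"
  shows "traverses Q \<sigma> s a a' \<longleftrightarrow> meets b \<sigma> \<and> traverses (half b Q e) (piece b \<sigma>) s a a'"
  using path_edges_piece[OF assms, of a] path_edges_piece[OF assms, of a']
  unfolding traverses_def by blast

end

section \<open>Cutting and gluing sets of serpents\<close>

lemma is_closed_iff: "is_closed \<sigma> \<longleftrightarrow> \<not> is_open \<sigma>"
  by (cases \<sigma>) auto

context inner_cut
begin

definition trace :: "bool \<Rightarrow> serpent set \<Rightarrow> serpent set" where
  "trace b \<Sigma> = piece b ` {\<sigma>\<in>\<Sigma>. meets b \<sigma>}"

lemma open_serpents_empty: "open_serpents Q {} = {}"
  by (auto simp: open_serpents_def polygon_sides_iff)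

lemma whole_representatives:
  "\<Sigma> \<in> whole.representatives \<longleftrightarrow> \<Sigma> \<subseteq> closed_serpents Q \<and> compatible Q \<Sigma>"
  by (simp add: whole.representatives_def open_serpents_empty)

lemma serpent_nests_eq: "serpent_nests Q = whole.representatives // whole.pattern_rel"
  unfolding whole.open_serpent_nests_eq[symmetric] serpent_nests_def open_serpent_nests_def
  by (simp add: open_serpents_empty)

lemma meets_some_side: "\<sigma> \<in> closed_serpents Q \<Longrightarrow> meets b \<sigma> \<or> meets (\<not> b) \<sigma>"
proof -
  assume \<sigma>: "\<sigma> \<in> closed_serpents Q"
  then have "extremities \<sigma> \<noteq> {}" using extremities_closed(2)[OF \<sigma>] by auto
  then obtain s where "s \<in> extremities \<sigma>" by blast
  then show ?thesis using side_cases[of s b] extremities_closed(1)[OF \<sigma>] by (auto simp: meets_def)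
qed

text \<open>
  Equal pieces have a common extremity at the centre of a square and leave it by the same side;
  then so do the original serpents, which compatibility excludes. In particular two serpents
  crossing \<open>e\<close> never have the same open piece, and a trace, although a set, forgets no multiplicity.
\<close>

lemma inj_on_piece:
  assumes \<Sigma>: "\<Sigma> \<in> whole.representatives"
  shows "inj_on (piece b) {\<sigma>\<in>\<Sigma>. meets b \<sigma>}"
proof (rule inj_onI, rule ccontr)
  fix \<sigma> \<tau> assume st: "\<sigma> \<in> {\<sigma>\<in>\<Sigma>. meets b \<sigma>}" "\<tau> \<in> {\<sigma>\<in>\<Sigma>. meets b \<sigma>}"
    and eq: "piece b \<sigma> = piece b \<tau>" and ne: "\<sigma> \<noteq> \<tau>"
  have cl: "\<sigma> \<in> closed_serpents Q" "\<tau> \<in> closed_serpents Q"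
    using st \<Sigma> by (auto simp: whole_representatives)
  obtain s where s: "s \<in> extremities \<sigma>" "s \<in> side b" using st(1) by (auto simp: meets_def)
  then have "s \<in> extremities (piece b \<sigma>)" using extremities_piece[OF cl(1) _ s(2)] st by simp
  then obtain a where "leaves_by (half b Q e) (piece b \<sigma>) s a"
    using part.unique_exit[OF piece_in_serpents[OF cl(1)]] st by blast
  then have "leaves_by Q \<sigma> s a" "leaves_by Q \<tau> s a"
    using leaves_by_piece[OF cl(1) s(2)] leaves_by_piece[OF cl(2) s(2)] st eq by auto
  then show False using \<Sigma> st ne by (auto simp: whole_representatives compatible_def)
qed

lemma trace_in_representatives:
  assumes \<Sigma>: "\<Sigma> \<in> whole.representatives"
  shows "trace b \<Sigma> \<in> part.representatives b"
proof -
  have cl: "\<sigma> \<in> closed_serpents Q" if "\<sigma> \<in> \<Sigma>" for \<sigma>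
    using that \<Sigma> by (auto simp: whole_representatives)
  have "trace b \<Sigma> \<subseteq> part.serpents b" using piece_in_serpents[OF cl] by (auto simp: trace_def)
  moreover have "compatible (half b Q e) (trace b \<Sigma>)"
    unfolding compatible_def
  proof (intro ballI impI allI notI, elim conjE)
    fix \<sigma>' \<tau>' s a assume "\<sigma>' \<in> trace b \<Sigma>" "\<tau>' \<in> trace b \<Sigma>" and ne: "\<sigma>' \<noteq> \<tau>'"
      and l: "leaves_by (half b Q e) \<sigma>' s a" "leaves_by (half b Q e) \<tau>' s a"
    then obtain \<sigma> \<tau> where st: "\<sigma> \<in> \<Sigma>" "meets b \<sigma>" "\<sigma>' = piece b \<sigma>"
      "\<tau> \<in> \<Sigma>" "meets b \<tau>" "\<tau>' = piece b \<tau>" by (auto simp: trace_def)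
    have "s \<in> side b" using l(1) part.extremities_subset_cells[OF piece_in_serpents[OF cl]] st
      unfolding leaves_by_def by blast
    then have "leaves_by Q \<sigma> s a" "leaves_by Q \<tau> s a"
      using l st leaves_by_piece[OF cl] by auto
    moreover have "\<sigma> \<noteq> \<tau>" using ne st by auto
    ultimately show False using \<Sigma> st(1,4) unfolding whole_representatives compatible_def by blast
  qed
  ultimately show ?thesis unfolding part.representatives_def by blast
qed

lemma card_trace:
  assumes "\<Sigma> \<in> whole.representatives"
    and "\<And>\<sigma>. \<sigma> \<in> \<Sigma> \<Longrightarrow> P \<sigma> \<longleftrightarrow> meets b \<sigma> \<and> P' (piece b \<sigma>)"
  shows "card {\<tau>\<in>trace b \<Sigma>. P' \<tau>} = card {\<sigma>\<in>\<Sigma>. P \<sigma>}"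
proof -
  have "{\<tau>\<in>trace b \<Sigma>. P' \<tau>} = piece b ` {\<sigma>\<in>\<Sigma>. P \<sigma>}"
    using assms(2) by (auto simp: trace_def)
  moreover have "inj_on (piece b) {\<sigma>\<in>\<Sigma>. P \<sigma>}"
    by (rule inj_on_subset[OF inj_on_piece[OF assms(1), of b]]) (use assms(2) in auto)
  ultimately show ?thesis by (simp add: card_image)
qed

text \<open>
  Every square lies on exactly one side, where the serpents and their pieces correspond one to one
  and look the same inside this square.
\<close>

lemma same_pattern_trace:
  assumes \<Sigma>: "\<Sigma> \<in> whole.representatives" and T: "T \<in> whole.representatives"
  shows "same_pattern Q \<Sigma> T \<longleftrightarrow> (\<forall>b. same_pattern (half b Q e) (trace b \<Sigma>) (trace b T))"
proof -
  have leaves: "card {\<tau>\<in>trace b \<Sigma>. leaves_by (half b Q e) \<tau> s a} = card {\<sigma>\<in>\<Sigma>. leaves_by Q \<sigma> s a}"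
    and trav: "card {\<tau>\<in>trace b \<Sigma>. traverses (half b Q e) \<tau> s a a'} =
      card {\<sigma>\<in>\<Sigma>. traverses Q \<sigma> s a a'}"
    if "s \<in> side b" "\<Sigma> \<in> whole.representatives" for b s a a' \<Sigma>
    using that leaves_by_piece[OF _ that(1)] traverses_piece[OF _ that(1)]
    by (intro card_trace, auto simp: whole_representatives)+
  have cells: "(\<forall>s\<in>cells Q. R s) \<longleftrightarrow> (\<forall>b. \<forall>s\<in>side b. R s)" for R
    using side_cases side_subset by blast
  show ?thesis unfolding same_pattern_def cells
    by (intro iff_allI ball_cong refl) (simp add: leaves trav \<Sigma> T)
qed

lemma card_open_trace:
  assumes "\<Sigma> \<in> whole.representatives"
  shows "card {\<tau>\<in>trace b \<Sigma>. is_open \<tau>} = card {\<sigma>\<in>\<Sigma>. meets True \<sigma> \<and> meets False \<sigma>}"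
proof (rule card_trace[OF assms])
  fix \<sigma> assume "\<sigma> \<in> \<Sigma>"
  then have "\<sigma> \<in> closed_serpents Q" using assms by (auto simp: whole_representatives)
  then show "meets True \<sigma> \<and> meets False \<sigma> \<longleftrightarrow> meets b \<sigma> \<and> is_open (piece b \<sigma>)"
    using is_open_piece[of \<sigma> b] by (cases b) auto
qed

text \<open>
  A serpent stays on one of the two sides, where its piece is closed, or crosses \<open>e\<close> and leaves
  one open piece on either side; counting these on one side only counts each crossing serpent once.
\<close>

lemma card_closed_trace:
  assumes \<Sigma>: "\<Sigma> \<in> whole.representatives"
  shows "card {\<sigma>\<in>\<Sigma>. is_closed \<sigma>} = card {\<tau>\<in>trace True \<Sigma>. is_closed \<tau>} +
    card {\<tau>\<in>trace False \<Sigma>. is_closed \<tau>} + card {\<tau>\<in>trace True \<Sigma>. is_open \<tau>}"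
proof -
  have cl: "\<sigma> \<in> closed_serpents Q" if "\<sigma> \<in> \<Sigma>" for \<sigma>
    using that \<Sigma> by (auto simp: whole_representatives)
  have fin: "finite \<Sigma>"
    by (rule finite_subset[OF _ finite_closed_serpents]) (use cl in blast)
  have one: "card {\<tau>\<in>trace b \<Sigma>. is_closed \<tau>} = card {\<sigma>\<in>\<Sigma>. meets b \<sigma> \<and> \<not> meets (\<not> b) \<sigma>}" for b
  proof (rule card_trace[OF \<Sigma>])
    fix \<sigma> assume \<sigma>: "\<sigma> \<in> \<Sigma>"
    show "meets b \<sigma> \<and> \<not> meets (\<not> b) \<sigma> \<longleftrightarrow> meets b \<sigma> \<and> is_closed (piece b \<sigma>)"
      using is_open_piece[OF cl[OF \<sigma>], of b] by (cases "meets b \<sigma>") (simp_all add: is_closed_iff)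
  qed
  let ?A = "{\<sigma>\<in>\<Sigma>. meets True \<sigma> \<and> \<not> meets False \<sigma>}" and ?B = "{\<sigma>\<in>\<Sigma>. meets False \<sigma> \<and> \<not> meets True \<sigma>}"
    and ?C = "{\<sigma>\<in>\<Sigma>. meets True \<sigma> \<and> meets False \<sigma>}"
  have parts: "{\<sigma>\<in>\<Sigma>. is_closed \<sigma>} = ?A \<union> ?B \<union> ?C"
  proof -
    have "is_closed \<sigma>" "meets True \<sigma> \<or> meets False \<sigma>" if "\<sigma> \<in> \<Sigma>" for \<sigma>
      using extremities_closed(4)[OF cl[OF that]] meets_some_side[OF cl[OF that], of True] by simp_all
    then show ?thesis by blast
  qed
  have "card (?A \<union> ?B \<union> ?C) = card (?A \<union> ?B) + card ?C"
    by (rule card_Un_disjoint) (use fin in auto)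
  moreover have "card (?A \<union> ?B) = card ?A + card ?B"
    by (rule card_Un_disjoint) (use fin in auto)
  moreover have "card {\<tau>\<in>trace True \<Sigma>. is_closed \<tau>} = card ?A"
    "card {\<tau>\<in>trace False \<Sigma>. is_closed \<tau>} = card ?B" using one[of True] one[of False] by simp_all
  ultimately show ?thesis unfolding parts card_open_trace[OF \<Sigma>, of True] by linarith
qed

text \<open>
  Any bijection between the open serpents on the two sides will do: compatibility is tested inside
  single squares, where a serpent can be replaced by its piece.
\<close>

lemma traces_can_be_glued:
  assumes P: "\<And>b. P b \<in> part.representatives b"
    and opens: "card {\<sigma>\<in>P True. is_open \<sigma>} = card {\<sigma>\<in>P False. is_open \<sigma>}"
  obtains \<Sigma> where "\<Sigma> \<in> whole.representatives" "\<And>b. trace b \<Sigma> = P b"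
proof -
  define opens_of where "opens_of b = {\<sigma>\<in>P b. is_open \<sigma>}" for b
  have serp: "P b \<subseteq> part.serpents b" and comp: "compatible (half b Q e) (P b)" for b
    using P[of b] by (simp_all add: part.representatives_def)
  have "finite (opens_of b)" for b
    using finite_subset[OF serp part.finite_serpents] by (simp add: opens_of_def)
  then obtain g where g: "bij_betw g (opens_of True) (opens_of False)"
    using opens finite_same_card_bij unfolding opens_of_def by blast
  \<comment> \<open>the partner of an open serpent of side \<open>b\<close>, on the opposite side\<close>
  define G where "G b = (if b then g else inv_into (opens_of True) g)" for b
  have G: "G b \<sigma> \<in> opens_of (\<not> b)" "G (\<not> b) (G b \<sigma>) = \<sigma>" if "\<sigma> \<in> opens_of b" for b \<sigma>
    using that g bij_betw_inv_into[OF g] bij_betw_inv_into_left[OF g] bij_betw_inv_into_right[OF g]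
      bij_betwE[OF g] bij_betwE[OF bij_betw_inv_into[OF g]]
    by (cases b; simp add: G_def)+
  define J where "J b \<sigma> = (if is_closed \<sigma> then \<sigma>
    else Closed_Serpent (extremities \<sigma> \<union> extremities (G b \<sigma>)))" for b \<sigma>
  have opens_of_serpent: "\<exists>s. \<sigma> = Open_Serpent s e \<and> s \<in> side b \<and> \<sigma> \<in> open_serpents (half b Q e) e"
    if "\<sigma> \<in> opens_of b" for b \<sigma>
  proof -
    have "\<sigma> \<notin> closed_serpents (half b Q e)" using that part.extremities_closed(4)
      by (auto simp: opens_of_def is_closed_iff)
    then have o: "\<sigma> \<in> open_serpents (half b Q e) e" using that serp[of b] by (auto simp: opens_of_def)
    then obtain s where "\<sigma> = Open_Serpent s e" unfolding open_serpents_def by blast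
    then show ?thesis using part.extremities_open(1)[OF o] o by simp
  qed
  have closed_inside: "\<sigma> \<in> closed_serpents Q \<and> extremities \<sigma> \<subseteq> side b"
    if "\<sigma> \<in> P b" "is_closed \<sigma>" for b \<sigma>
  proof -
    have "\<sigma> \<notin> open_serpents (half b Q e) e" using that part.extremities_open(3)
      by (auto simp: is_closed_iff)
    then show ?thesis using that serp[of b] closed_serpents_half by blast
  qed
  have J: "J b \<sigma> \<in> closed_serpents Q \<and> meets b (J b \<sigma>) \<and> piece b (J b \<sigma>) = \<sigma>"
    if \<sigma>: "\<sigma> \<in> P b" for b \<sigma>
  proof (cases "is_closed \<sigma>")
    case True
    have "J b \<sigma> = \<sigma>" using True by (simp add: J_def)
    moreover have "\<sigma> \<in> closed_serpents Q" "extremities \<sigma> \<subseteq> side b"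
      using closed_inside[OF \<sigma> True] by simp_all
    moreover have "extremities \<sigma> \<noteq> {}" using extremities_closed(2)[OF \<open>\<sigma> \<in> closed_serpents Q\<close>] by auto
    ultimately show ?thesis by (auto simp: meets_def piece_def)
  next
    case False
    then have in_opens: "\<sigma> \<in> opens_of b" using \<sigma> by (simp add: opens_of_def is_closed_iff)
    obtain s where s: "\<sigma> = Open_Serpent s e" "s \<in> side b" "\<sigma> \<in> open_serpents (half b Q e) e"
      using opens_of_serpent[OF in_opens] by blast
    obtain t where t: "G b \<sigma> = Open_Serpent t e" "t \<in> side (\<not> b)"
      "G b \<sigma> \<in> open_serpents (half (\<not> b) Q e) e"
      using opens_of_serpent[OF G(1)[OF in_opens]] by blast
    have Js: "J b \<sigma> = Closed_Serpent {s, t}" using False s(1) t(1) by (auto simp: J_def)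
    have "Closed_Serpent {s, t} \<in> closed_serpents Q"
      by (rule joined_serpent) (use s t in simp_all)
    moreover have "t \<notin> side b" using side_disjoint[of t "\<not> b"] t(2) by simp
    moreover have "{s, t} \<inter> side b = {s}" using \<open>t \<notin> side b\<close> s(2) by auto
    ultimately show ?thesis unfolding Js using s(1) by (simp add: meets_def piece_def)
  qed
  define \<Sigma> where "\<Sigma> = J True ` P True \<union> J False ` P False"
  have in_\<Sigma>: "J b ` P b \<subseteq> \<Sigma>" for b by (cases b) (auto simp: \<Sigma>_def)
  \<comment> \<open>a member that meets side \<open>b\<close> but comes from the other side is the join of two open partners, hence also a join formed from side \<open>b\<close>\<close>
  have \<Sigma>_cases: "\<exists>\<sigma>\<in>P b. \<tau> = J b \<sigma>" if \<tau>: "\<tau> \<in> \<Sigma>" "meets b \<tau>" for \<tau> b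
  proof -
    have "\<tau> \<in> J b ` P b \<or> \<tau> \<in> J (\<not> b) ` P (\<not> b)" using \<tau>(1) by (cases b) (auto simp: \<Sigma>_def)
    then show ?thesis
    proof
      assume "\<tau> \<in> J (\<not> b) ` P (\<not> b)"
      then obtain \<rho> where \<rho>: "\<rho> \<in> P (\<not> b)" "\<tau> = J (\<not> b) \<rho>" by blast
      have "\<not> is_closed \<rho>"
      proof
        assume c: "is_closed \<rho>"
        then have "\<tau> = \<rho>" using \<rho> by (simp add: J_def)
        then have "extremities \<tau> \<subseteq> side (\<not> b)" using closed_inside[OF \<rho>(1) c] by simp
        then show False using \<tau>(2) side_disjoint[of _ b] by (auto simp: meets_def)
      qed
      then have in_opens: "\<rho> \<in> opens_of (\<not> b)" using \<rho>(1) by (simp add: opens_of_def is_closed_iff)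
      have G': "G (\<not> b) \<rho> \<in> opens_of b" "G b (G (\<not> b) \<rho>) = \<rho>" using G[OF in_opens] by simp_all
      then have "\<not> is_closed (G (\<not> b) \<rho>)" by (auto simp: opens_of_def is_closed_iff)
      then have "J b (G (\<not> b) \<rho>) = \<tau>"
        using \<rho>(2) \<open>\<not> is_closed \<rho>\<close> G'(2) by (simp add: J_def Un_commute)
      then show ?thesis using G'(1) by (auto simp: opens_of_def)
    qed blast
  qed
  have closed: "\<Sigma> \<subseteq> closed_serpents Q"
  proof
    fix \<tau> assume "\<tau> \<in> \<Sigma>"
    then obtain b \<sigma> where "\<sigma> \<in> P b" "\<tau> = J b \<sigma>" unfolding \<Sigma>_def by blast
    then show "\<tau> \<in> closed_serpents Q" using J[of \<sigma> b] by simp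
  qed
  have "compatible Q \<Sigma>" unfolding compatible_def
  proof (intro ballI impI allI notI, elim conjE)
    fix \<sigma> \<tau> s a assume st: "\<sigma> \<in> \<Sigma>" "\<tau> \<in> \<Sigma>" "\<sigma> \<noteq> \<tau>" and l: "leaves_by Q \<sigma> s a" "leaves_by Q \<tau> s a"
    have cl: "\<sigma> \<in> closed_serpents Q" "\<tau> \<in> closed_serpents Q" using st closed by blast+
    have "s \<in> cells Q" using l(1) extremities_closed(1)[OF cl(1)] by (auto simp: leaves_by_def)
    then obtain b where b: "s \<in> side b" by (rule cell_in_half[OF _ e])
    have m: "meets b \<sigma>" "meets b \<tau>" using l b by (auto simp: leaves_by_def meets_def)
    obtain \<sigma>' where s': "\<sigma>' \<in> P b" "\<sigma> = J b \<sigma>'" using \<Sigma>_cases[OF st(1) m(1)] by blast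
    obtain \<tau>' where t': "\<tau>' \<in> P b" "\<tau> = J b \<tau>'" using \<Sigma>_cases[OF st(2) m(2)] by blast
    have "piece b \<sigma> = \<sigma>'" "piece b \<tau> = \<tau>'" using J[OF s'(1)] J[OF t'(1)] s'(2) t'(2) by simp_all
    then have "\<sigma>' \<noteq> \<tau>'" "leaves_by (half b Q e) \<sigma>' s a" "leaves_by (half b Q e) \<tau>' s a"
      using l leaves_by_piece[OF cl(1) b, of a] leaves_by_piece[OF cl(2) b, of a]
        s'(2) t'(2) st(3) by auto
    then show False using comp[of b] s'(1) t'(1) unfolding compatible_def by blast
  qed
  moreover note closed
  moreover have "trace b \<Sigma> = P b" for b
  proof -
    have "{\<sigma>\<in>\<Sigma>. meets b \<sigma>} = J b ` P b" using \<Sigma>_cases[of _ b] in_\<Sigma>[of b] J by blast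
    then show ?thesis using J by (simp add: trace_def image_image)
  qed
  ultimately show thesis using that by (simp add: whole_representatives)
qed

section \<open>Nests as glued pairs of open nests\<close>

text \<open>
  The traces of the members of a nest lie in a single class, so the image below is an open nest.
\<close>

definition nest_on_side :: "bool \<Rightarrow> serpent set set \<Rightarrow> serpent set set" where
  "nest_on_side b N = part.pattern_rel b `` (trace b ` N)"

lemma trace_related:
  "(\<Sigma>, T) \<in> whole.pattern_rel \<longleftrightarrow> \<Sigma> \<in> whole.representatives \<and> T \<in> whole.representatives \<and>
     (\<forall>b. (trace b \<Sigma>, trace b T) \<in> part.pattern_rel b)"
  unfolding whole.pattern_rel_def part.pattern_rel_def
  using same_pattern_trace trace_in_representatives by auto

lemma nest_on_side_class:
  assumes "\<Sigma> \<in> whole.representatives"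
  shows "nest_on_side b (whole.pattern_rel `` {\<Sigma>}) = part.pattern_rel b `` {trace b \<Sigma>}"
proof -
  have tr: "trans (part.pattern_rel b)" using part.equiv_pattern_rel by (rule equivE)
  have self: "\<Sigma> \<in> whole.pattern_rel `` {\<Sigma>}"
    using equiv_class_self[OF whole.equiv_pattern_rel assms] .
  show ?thesis
  proof
    show "part.pattern_rel b `` {trace b \<Sigma>} \<subseteq> nest_on_side b (whole.pattern_rel `` {\<Sigma>})"
      using self unfolding nest_on_side_def by blast
    show "nest_on_side b (whole.pattern_rel `` {\<Sigma>}) \<subseteq> part.pattern_rel b `` {trace b \<Sigma>}"
    proof
      fix X assume "X \<in> nest_on_side b (whole.pattern_rel `` {\<Sigma>})"
      then obtain T where T: "(\<Sigma>, T) \<in> whole.pattern_rel" "(trace b T, X) \<in> part.pattern_rel b"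
        unfolding nest_on_side_def by blast
      then have "(trace b \<Sigma>, trace b T) \<in> part.pattern_rel b" using trace_related by blast
      then have "(trace b \<Sigma>, X) \<in> part.pattern_rel b" using T(2) by (rule transD[OF tr])
      then show "X \<in> part.pattern_rel b `` {trace b \<Sigma>}" by blast
    qed
  qed
qed

abbreviation side_nests :: "bool \<Rightarrow> serpent set set set" where
  "side_nests b \<equiv> part.representatives b // part.pattern_rel b"

text \<open>
  Injectivity holds because a pattern in \<open>Q\<close> is a pair of patterns on the two sides, surjectivity by
  gluing representatives.
\<close>

lemma bij_betw_nests_on_sides:
  "bij_betw (\<lambda>N. (nest_on_side True N, nest_on_side False N))
     (whole.representatives // whole.pattern_rel)
     {(N', N''). N' \<in> side_nests True \<and> N'' \<in> side_nests False \<and> op_rk N' = op_rk N''}"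
  (is "bij_betw ?\<Phi> ?W ?Z")
proof (rule bij_betw_imageI)
  show "inj_on ?\<Phi> ?W"
  proof (rule inj_onI)
    fix N M assume "N \<in> ?W" "M \<in> ?W" and eq: "?\<Phi> N = ?\<Phi> M"
    then obtain \<Sigma> T where \<Sigma>: "N = whole.pattern_rel `` {\<Sigma>}" "\<Sigma> \<in> whole.representatives"
      and T: "M = whole.pattern_rel `` {T}" "T \<in> whole.representatives"
      by (elim quotientE)
    have "nest_on_side b N = nest_on_side b M" for b using eq by (cases b) simp_all
    then have "part.pattern_rel b `` {trace b \<Sigma>} = part.pattern_rel b `` {trace b T}" for b
      using nest_on_side_class[OF \<Sigma>(2), of b] nest_on_side_class[OF T(2), of b] \<Sigma>(1) T(1) by simp
    then have "(trace b \<Sigma>, trace b T) \<in> part.pattern_rel b" for b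
      using eq_equiv_class[OF _ part.equiv_pattern_rel trace_in_representatives[OF T(2)]] by blast
    then have "(\<Sigma>, T) \<in> whole.pattern_rel" using trace_related \<Sigma>(2) T(2) by simp
    then show "N = M" unfolding \<Sigma>(1) T(1) by (rule equiv_class_eq[OF whole.equiv_pattern_rel])
  qed
  show "?\<Phi> ` ?W = ?Z"
  proof (intro equalityI subsetI)
    fix X assume "X \<in> ?\<Phi> ` ?W"
    then obtain N where N: "N \<in> ?W" "X = ?\<Phi> N" by blast
    from N(1) obtain \<Sigma> where \<Sigma>: "\<Sigma> \<in> whole.representatives" "N = whole.pattern_rel `` {\<Sigma>}"
      by (elim quotientE)
    have side: "nest_on_side b N = part.pattern_rel b `` {trace b \<Sigma>}" for b
      using nest_on_side_class[OF \<Sigma>(1)] \<Sigma>(2) by simp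
    have "nest_on_side b N \<in> side_nests b" for b
      unfolding side by (rule quotientI) (rule trace_in_representatives[OF \<Sigma>(1)])
    moreover have "op_rk (nest_on_side b N) = card {\<sigma>\<in>\<Sigma>. meets True \<sigma> \<and> meets False \<sigma>}" for b
      unfolding side part.ranks_of_class(2)[OF trace_in_representatives[OF \<Sigma>(1)]]
      by (rule card_open_trace[OF \<Sigma>(1)])
    ultimately show "X \<in> ?Z" unfolding N(2) by simp
  next
    fix X assume "X \<in> ?Z"
    then obtain N' N'' where X: "X = (N', N'')" "N' \<in> side_nests True" "N'' \<in> side_nests False"
      "op_rk N' = op_rk N''" by blast
    from X(2) obtain \<Sigma>' where s': "\<Sigma>' \<in> part.representatives True" "N' = part.pattern_rel True `` {\<Sigma>'}"
      by (elim quotientE)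
    from X(3) obtain \<Sigma>'' where s'': "\<Sigma>'' \<in> part.representatives False"
      "N'' = part.pattern_rel False `` {\<Sigma>''}" by (elim quotientE)
    define P where "P b = (if b then \<Sigma>' else \<Sigma>'')" for b
    have P: "P b \<in> part.representatives b" for b using s' s'' by (cases b) (simp_all add: P_def)
    have "card {\<sigma>\<in>P True. is_open \<sigma>} = card {\<sigma>\<in>P False. is_open \<sigma>}"
      using X(4) part.ranks_of_class(2)[OF s'(1)] part.ranks_of_class(2)[OF s''(1)] s' s''
      by (simp add: P_def)
    then obtain \<Sigma> where \<Sigma>: "\<Sigma> \<in> whole.representatives" "\<And>b. trace b \<Sigma> = P b"
      using traces_can_be_glued[OF P] by blast
    have "?\<Phi> (whole.pattern_rel `` {\<Sigma>}) = X"
      using nest_on_side_class[OF \<Sigma>(1)] \<Sigma>(2) s' s'' X(1) by (simp add: P_def)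
    moreover have "whole.pattern_rel `` {\<Sigma>} \<in> ?W" using \<Sigma>(1) by (rule quotientI)
    ultimately show "X \<in> ?\<Phi> ` ?W" by blast
  qed
qed

lemma rk_nests_on_sides:
  assumes "N \<in> whole.representatives // whole.pattern_rel"
  shows "rk N = rk (nest_on_side True N) + rk (nest_on_side False N) + op_rk (nest_on_side True N)"
proof -
  from assms obtain \<Sigma> where \<Sigma>: "\<Sigma> \<in> whole.representatives" "N = whole.pattern_rel `` {\<Sigma>}"
    by (elim quotientE)
  have side: "nest_on_side b N = part.pattern_rel b `` {trace b \<Sigma>}" for b
    using nest_on_side_class[OF \<Sigma>(1)] \<Sigma>(2) by simp
  have tr: "trace b \<Sigma> \<in> part.representatives b" for b by (rule trace_in_representatives[OF \<Sigma>(1)])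
  have "rk N = card {\<sigma>\<in>\<Sigma>. is_closed \<sigma>}"
    unfolding \<Sigma>(2) by (rule whole.ranks_of_class(1)[OF \<Sigma>(1)])
  then show ?thesis
    unfolding side part.ranks_of_class[OF tr]
    using card_closed_trace[OF \<Sigma>(1)] by simp
qed

end

text \<open>
  Expanding the product over pairs of monomials, only pairs with equal exponents of \<open>t\<close> survive.
\<close>

lemma glue_sum_monom:
  fixes p r :: "'a \<Rightarrow> nat" and p' r' :: "'b \<Rightarrow> nat"
  assumes "finite I" and "finite J"
  shows "glue (\<Sum>i\<in>I. monom (monom 1 (r i)) (p i)) (\<Sum>j\<in>J. monom (monom 1 (r' j)) (p' j)) =
    (\<Sum>(i, j) | i \<in> I \<and> j \<in> J \<and> p i = p' j. monom 1 (r i + r' j + p i))"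
proof -
  define A :: "int poly poly" where "A = (\<Sum>i\<in>I. monom (monom 1 (r i)) (p i))"
  define B :: "int poly poly" where "B = (\<Sum>j\<in>J. monom (monom 1 (r' j)) (p' j))"
  \<comment> \<open>a summation bound that covers all exponents \<open>p i\<close> as well as both degrees\<close>
  define K where "K = max (degree A) (degree B) + sum p I"
  have pK: "p i \<le> K" if "i \<in> I" for i
    using member_le_sum[OF that, of p] assms(1) by (simp add: K_def)
  have A: "coeff A k = (\<Sum>i\<in>I. if p i = k then monom 1 (r i) else 0)" for k
    by (simp add: A_def coeff_sum)
  have B: "coeff B k = (\<Sum>j\<in>J. if p' j = k then monom 1 (r' j) else 0)" for k
    by (simp add: B_def coeff_sum)
  have "glue A B = (\<Sum>k\<le>K. coeff A k * coeff B k * monom 1 k)"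
    unfolding glue_def
    by (rule sum.mono_neutral_left) (auto simp: K_def not_le coeff_eq_0)
  also have "\<dots> = (\<Sum>k\<le>K. \<Sum>i\<in>I. \<Sum>j\<in>J.
      if k = p i then (if p i = p' j then monom 1 (r i + r' j + p i) else 0) else 0)"
    unfolding A B unfolding sum_product unfolding sum_distrib_right
    by (intro sum.cong refl) (auto simp: mult_monom)
  also have "\<dots> = (\<Sum>i\<in>I. \<Sum>j\<in>J. \<Sum>k\<le>K.
      if k = p i then (if p i = p' j then monom 1 (r i + r' j + p i) else 0) else 0)"
    by (subst sum.swap, rule sum.cong[OF refl], rule sum.swap)
  also have "\<dots> = (\<Sum>i\<in>I. \<Sum>j\<in>J. if p i = p' j then monom 1 (r i + r' j + p i) else 0)"
    using pK by (intro sum.cong refl) simp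
  also have "\<dots> = (\<Sum>(i, j)\<in>I \<times> J. if p i = p' j then monom 1 (r i + r' j + p i) else 0)"
    by (rule sum.cartesian_product)
  also have "\<dots> = (\<Sum>(i, j) | i \<in> I \<and> j \<in> J \<and> p i = p' j. monom 1 (r i + r' j + p i))"
    using assms by (intro sum.mono_neutral_cong_right) (auto split: if_splits)
  finally show ?thesis unfolding A_def B_def .
qed

context inner_cut
begin

lemma h_vector_eq_glue:
  "h_vector Q = glue (open_h_vector (half True Q e) e) (open_h_vector (half False Q e) e)"
proof -
  let ?Z = "{(N', N''). N' \<in> side_nests True \<and> N'' \<in> side_nests False \<and> op_rk N' = op_rk N''}"
  have "h_vector Q = (\<Sum>N\<in>whole.representatives // whole.pattern_rel.
      (\<lambda>(N', N''). monom 1 (rk N' + rk N'' + op_rk N')) (nest_on_side True N, nest_on_side False N))"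
    unfolding h_vector_def serpent_nests_eq by (intro sum.cong refl) (simp add: rk_nests_on_sides)
  also have "\<dots> = (\<Sum>(N', N'')\<in>?Z. monom 1 (rk N' + rk N'' + op_rk N'))"
    by (rule sum.reindex_bij_betw[OF bij_betw_nests_on_sides])
  also have "\<dots> = glue (open_h_vector (half True Q e) e) (open_h_vector (half False Q e) e)"
    unfolding open_h_vector_def part.open_serpent_nests_eq
    by (rule glue_sum_monom[OF part.finite_nests part.finite_nests, symmetric])
  finally show ?thesis .
qed

end

lemma cut_eq_half:
  assumes "card e = 2"
  shows "cut_between Q e = half True Q e" and "cut_around Q e = half False Q e"
proof -
  obtain u v where uv: "e = {u, v}" "u < v" "beyond True e = {x. u < x \<and> x < v}"
    "beyond False e = {x. x < u \<or> v < x}" using assms by (rule two_set_cases)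
  then have m: "Min e = u" "Max e = v" by auto
  have "{w \<in> verts Q. u \<le> w \<and> w \<le> v} = verts Q \<inter> (beyond True e \<union> e)"
    "{w \<in> verts Q. w \<le> u \<or> v \<le> w} = verts Q \<inter> (beyond False e \<union> e)"
    unfolding uv(3,4) using uv(1,2) by auto
  then show "cut_between Q e = half True Q e" "cut_around Q e = half False Q e"
    by (simp_all add: cut_between_def cut_around_def half_def m)
qed

theorem proposition4p8:
  fixes Q :: dissection and e :: edge
  assumes "quadrangulation Q"
    and "e \<in> inner_edges Q"
  shows "h_vector Q = glue (open_h_vector (cut_between Q e) e) (open_h_vector (cut_around Q e) e)"
proof -
  interpret inner_cut Q e
    using assms by unfold_locales (auto simp: quadrangulation_def)
  show ?thesis using h_vector_eq_glue inner_edge[OF e] by (simp add: cut_eq_half)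
qed

end
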